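(* Let $I$ and $J$ be two skew-symmetric $(1,1)$-tensors on a pre-Courant algebroid $(E,\Theta)$ such that $(J,I)$ is a Poisson-Nijenhuis pair for $\Theta$ and $\Theta_{\{J,\{I,J\}\}}=0$. Then: (1) $I^n\circ J$ is a Poisson tensor for $\Theta_k$, for all $n,k\in\mathbb{N}$; (2) for all $k\in\mathbb{N}$, the family $(I^n\circ J)_{n\in\mathbb{N}}$ consists of pairwise compatible Poisson tensors for $\Theta_k$; (3) $(I^n\circ J,I^{2m+1})$ is a Poisson-Nijenhuis pair for $\Theta_k$, for all $m,n,k\in\mathbb{N}$.
   Context: $E\to M$ is a real vector bundle over a smooth manifold with a fibrewise non-degenerate symmetric bilinear form $\langle\cdot,\cdot\rangle$. A pre-Courant structure $\Theta$ on it is a pair $(\rho,[\cdot,\cdot])$, where $\rho:E\to TM$ is a bundle map and $[\cdot,\cdot]$ is an $\mathbb{R}$-bilinear, not necessarily skew-symmetric, bracket on $\Gamma(E)$ such that, for all $X,Y,Z\in\Gamma(E)$, $\rho(X)\cdot\langle Y,Z\rangle=\langle[X,Y],Z\rangle+\langle Y,[X,Z]\rangle$ and $\rho(X)\cdot\langle Y,Z\rangle=\langle X,[Y,Z]+[Z,Y]\rangle$. Then $(E,\Theta)$ is a pre-Courant algebroid. Sums and scalar multiples of pre-Courant structures are taken componentwise. A $(1,1)$-tensor is a vector bundle endomorphism of $E$ over $\mathrm{id}_M$; $J$ is skew-symmetric if $\langle Ju,v\rangle+\langle u,Jv\rangle=0$. For $J$ skew-symmetric, $\Theta_J=(\rho\circ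 J,[\cdot,\cdot]_J)$ with $[X,Y]_J=[JX,Y]+[X,JY]-J[X,Y]$, which is again a pre-Courant structure. Write $\Theta_{I,J}=(\Theta_I)_J$. $\Theta_0=\Theta$ and $\Theta_k=(\Theta_{k-1})_I$ ($k$ successive deformations by $I$). For skew-symmetric $I,J$, $\{J,I\}$ denotes the skew-symmetric $(1,1)$-tensor $I\circ J-J\circ I$ (the Poisson bracket of the corresponding degree 2 functions in the supergeometric formalism). $I^n$ is the $n$-fold composition, $I^0=\mathrm{id}_E$. $\mathbb{N}$ includes $0$. $I$ is Nijenhuis for $\Theta$ if $[IX,IY]-I([X,Y]_I)=0$ for all $X,Y\in\Gamma(E)$. A skew-symmetric $J$ is a Poisson tensor for $\Theta$ if $\Theta_{J,J}=0$. Two Poisson tensors $J,J'$ for $\Theta$ are compatible if $J+J'$ is a Poisson tensor for $\Theta$. A pair of skew-symmetric $(1,1)$-tensors $(I,J)$ is a compatible pair w.r.t. $\Theta$ if $I\circ J=-J\circ I$ and $C_\Theta(I,J):=\Theta_{I,J}+\Theta_{J,I}=0$. $(J,I)$ is a Poisson-Nijenhuis pair for $\Theta$ if $(J,I)$ is a compatible pair w.r.t. $\Theta$, $J$ is Poisson for $\Theta$ and $I$ is Nijenhuis for $\Theta$. *)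

theory Defs
  imports "HOL-Analysis.Analysis"
begin

section \<open>Smooth manifolds\<close>

text \<open>
  Model spaces and model fibres are finite-dimensional normed spaces instead of
  \<^class>\<open>euclidean_space\<close>, because the latter excludes dimension 0, i.e. manifolds of
  dimension 0 (quadratic algebras over a point) and bundles of rank 0.
\<close>

definition finite_dim :: "'a::real_normed_vector itself \<Rightarrow> bool" where
  "finite_dim _ \<longleftrightarrow> (\<exists>B :: 'a set. finite B \<and> span B = UNIV)"

text \<open>The following two notions are used for open \<open>S\<close> only.\<close>

primrec Ck_on :: "nat \<Rightarrow> ('a::real_normed_vector \<Rightarrow> 'b::real_normed_vector) \<Rightarrow> 'a set \<Rightarrow> bool" where
  "Ck_on 0 f S \<longleftrightarrow> continuous_on S f"
| "Ck_on (Suc k) f S \<longleftrightarrow>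
     (\<forall>x\<in>S. f differentiable (at x)) \<and> (\<forall>v. Ck_on k (\<lambda>x. frechet_derivative f (at x) v) S)"

definition smooth_on :: "('a::real_normed_vector \<Rightarrow> 'b::real_normed_vector) \<Rightarrow> 'a set \<Rightarrow> bool" where
  "smooth_on f S \<longleftrightarrow> (\<forall>k. Ck_on k f S)"

text \<open>
  A smooth manifold is given by a (not necessarily maximal) smooth atlas on a Hausdorff second
  countable space; the points of the manifold are all elements of the type \<open>'m\<close>.
\<close>

type_synonym ('m, 'n) atlas = "('m set \<times> ('m \<Rightarrow> 'n)) set"

definition smooth_manifold ::
  "('m::{t2_space, second_countable_topology}, 'n::real_normed_vector) atlas \<Rightarrow> bool" where
  "smooth_manifold A \<longleftrightarrow>
     finite_dim TYPE('n) \<and>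
     (\<Union>(U, \<phi>)\<in>A. U) = UNIV \<and>
     (\<forall>(U, \<phi>)\<in>A. open U \<and> open (\<phi> ` U) \<and> homeomorphism U (\<phi> ` U) \<phi> (inv_into U \<phi>)) \<and>
     (\<forall>(U, \<phi>)\<in>A. \<forall>(V, \<psi>)\<in>A. smooth_on (\<psi> \<circ> inv_into U \<phi>) (\<phi> ` (U \<inter> V)))"

definition smooth_map_on ::
  "('m, 'n::real_normed_vector) atlas \<Rightarrow> 'm set \<Rightarrow> ('m \<Rightarrow> 'b::real_normed_vector) \<Rightarrow> bool" where
  "smooth_map_on A W f \<longleftrightarrow> (\<forall>(U, \<phi>)\<in>A. smooth_on (f \<circ> inv_into U \<phi>) (\<phi> ` (U \<inter> W)))"

definition smooth_functions :: "('m, 'n::real_normed_vector) atlas \<Rightarrow> ('m \<Rightarrow> real) set" where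
  "smooth_functions A = {f. smooth_map_on A UNIV f}"


section \<open>Vector bundles\<close>

text \<open>
  A vector bundle is given by its total space (a set), its projection, the fibrewise linear
  operations and a vector bundle atlas. A local trivialization over \<open>U\<close> is recorded by its
  fibre component \<open>\<psi>\<close>, i.e. it is \<open>e \<mapsto> (proj e, \<psi> e)\<close>; the topology and the smooth structure
  of the total space are those determined by the trivializations.
\<close>

record ('m, 'e, 'f) vbundle =
  tot_space :: "'e set"
  bproj :: "'e \<Rightarrow> 'm"
  fadd :: "'e \<Rightarrow> 'e \<Rightarrow> 'e"
  fscale :: "real \<Rightarrow> 'e \<Rightarrow> 'e"
  fzero :: "'m \<Rightarrow> 'e"
  trivs :: "('m set \<times> ('e \<Rightarrow> 'f)) set"

definition fibre :: "('m, 'e, 'f) vbundle \<Rightarrow> 'm \<Rightarrow> 'e set" where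
  "fibre E p = {e \<in> tot_space E. bproj E e = p}"

abbreviation triv_inv :: "('m, 'e, 'f) vbundle \<Rightarrow> ('e \<Rightarrow> 'f) \<Rightarrow> 'm \<Rightarrow> 'f \<Rightarrow> 'e" where
  "triv_inv E \<psi> p \<equiv> inv_into (fibre E p) \<psi>"

text \<open>
  The fibre operations are required to correspond to those of the model fibre, which makes every
  fibre a real vector space. Since the transition maps and the local representatives of bundle
  maps are linear in the finite-dimensional model fibre, their smoothness is tested on each fixed
  vector \<open>w\<close> of the model fibre (smoothness of all matrix coefficients).
\<close>

definition vector_bundle ::
  "('m::{t2_space, second_countable_topology}, 'n::real_normed_vector) atlas \<Rightarrow>
   ('m, 'e, 'f::real_normed_vector) vbundle \<Rightarrow> bool" where
  "vector_bundle A E \<longleftrightarrow>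
     finite_dim TYPE('f) \<and>
     (\<Union>(U, \<psi>)\<in>trivs E. U) = UNIV \<and>
     (\<forall>(U, \<psi>)\<in>trivs E. open U \<and>
        (\<forall>p\<in>U. bij_betw \<psi> (fibre E p) UNIV \<and>
           fzero E p \<in> fibre E p \<and> \<psi> (fzero E p) = 0 \<and>
           (\<forall>u\<in>fibre E p. \<forall>v\<in>fibre E p.
              fadd E u v \<in> fibre E p \<and> \<psi> (fadd E u v) = \<psi> u + \<psi> v) \<and>
           (\<forall>c. \<forall>u\<in>fibre E p.
              fscale E c u \<in> fibre E p \<and> \<psi> (fscale E c u) = c *\<^sub>R \<psi> u))) \<and>
     (\<forall>(U, \<psi>)\<in>trivs E. \<forall>(U', \<psi>')\<in>trivs E. \<forall>w.
        smooth_map_on A (U \<inter> U') (\<lambda>p. \<psi>' (triv_inv E \<psi> p w)))"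

definition bundle_map ::
  "('m, 'n::real_normed_vector) atlas \<Rightarrow> ('m, 'e, 'f::real_normed_vector) vbundle \<Rightarrow>
   ('m, 'd, 'h::real_normed_vector) vbundle \<Rightarrow> ('e \<Rightarrow> 'd) \<Rightarrow> bool" where
  "bundle_map A E D F \<longleftrightarrow>
     (\<forall>p. \<forall>u\<in>fibre E p. F u \<in> fibre D p) \<and>
     (\<forall>p. \<forall>u\<in>fibre E p. \<forall>v\<in>fibre E p. F (fadd E u v) = fadd D (F u) (F v)) \<and>
     (\<forall>p c. \<forall>u\<in>fibre E p. F (fscale E c u) = fscale D c (F u)) \<and>
     (\<forall>(U, \<psi>)\<in>trivs E. \<forall>(U', \<psi>')\<in>trivs D. \<forall>w.
        smooth_map_on A (U \<inter> U') (\<lambda>p. \<psi>' (F (triv_inv E \<psi> p w))))"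

definition sections ::
  "('m, 'n::real_normed_vector) atlas \<Rightarrow> ('m, 'e, 'f::real_normed_vector) vbundle \<Rightarrow>
   ('m \<Rightarrow> 'e) set" where
  "sections A E =
     {X. (\<forall>p. X p \<in> fibre E p) \<and> (\<forall>(U, \<psi>)\<in>trivs E. smooth_map_on A U (\<lambda>p. \<psi> (X p)))}"

definition sec_add :: "('m, 'e, 'f) vbundle \<Rightarrow> ('m \<Rightarrow> 'e) \<Rightarrow> ('m \<Rightarrow> 'e) \<Rightarrow> 'm \<Rightarrow> 'e" where
  "sec_add E X Y = (\<lambda>p. fadd E (X p) (Y p))"

definition sec_scale :: "('m, 'e, 'f) vbundle \<Rightarrow> real \<Rightarrow> ('m \<Rightarrow> 'e) \<Rightarrow> 'm \<Rightarrow> 'e" where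
  "sec_scale E c X = (\<lambda>p. fscale E c (X p))"

definition sec_diff :: "('m, 'e, 'f) vbundle \<Rightarrow> ('m \<Rightarrow> 'e) \<Rightarrow> ('m \<Rightarrow> 'e) \<Rightarrow> 'm \<Rightarrow> 'e" where
  "sec_diff E X Y = sec_add E X (sec_scale E (- 1) Y)"


section \<open>The tangent bundle\<close>

text \<open>
  Tangent vectors at \<open>p\<close> are derivations of the smooth functions at \<open>p\<close>, extended by 0 to the
  non-smooth functions so that equality of tangent vectors is equality in HOL.
\<close>

definition derivation_at ::
  "('m, 'n::real_normed_vector) atlas \<Rightarrow> 'm \<Rightarrow> (('m \<Rightarrow> real) \<Rightarrow> real) \<Rightarrow> bool" where
  "derivation_at A p v \<longleftrightarrow>
     (\<forall>f\<in>smooth_functions A. \<forall>h\<in>smooth_functions A.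
        (\<forall>a b. v (\<lambda>x. a * f x + b * h x) = a * v f + b * v h) \<and>
        v (\<lambda>x. f x * h x) = f p * v h + h p * v f) \<and>
     (\<forall>f. f \<notin> smooth_functions A \<longrightarrow> v f = 0)"

type_synonym 'm tangent = "'m \<times> (('m \<Rightarrow> real) \<Rightarrow> real)"

text \<open>
  A chart \<open>(U, \<phi>)\<close> trivializes the tangent bundle over \<open>U\<close>: the fibre component of a tangent
  vector is the vector \<open>w\<close> of the model space with \<open>v(f) = D(f \<circ> \<phi>\<^sup>-\<^sup>1)(\<phi>(p)) w\<close>.
\<close>

definition tangent_coord ::
  "('m, 'n::real_normed_vector) atlas \<Rightarrow> 'm set \<Rightarrow> ('m \<Rightarrow> 'n) \<Rightarrow> 'm tangent \<Rightarrow> 'n" where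
  "tangent_coord A U \<phi> v =
     (THE w. \<forall>f\<in>smooth_functions A.
        snd v f = frechet_derivative (f \<circ> inv_into U \<phi>) (at (\<phi> (fst v))) w)"

definition tangent_bundle ::
  "('m, 'n::real_normed_vector) atlas \<Rightarrow> ('m, 'm tangent, 'n) vbundle" where
  "tangent_bundle A =
     \<lparr>tot_space = {(p, v). derivation_at A p v},
      bproj = fst,
      fadd = (\<lambda>(p, v) (_, w). (p, \<lambda>f. v f + w f)),
      fscale = (\<lambda>c (p, v). (p, \<lambda>f. c * v f)),
      fzero = (\<lambda>p. (p, \<lambda>f. 0)),
      trivs = {(U, tangent_coord A U \<phi>) | U \<phi>. (U, \<phi>) \<in> A}\<rparr>"


section \<open>Pre-Courant algebroids\<close>

definition bundle_metric ::
  "('m, 'n::real_normed_vector) atlas \<Rightarrow> ('m, 'e, 'f::real_normed_vector) vbundle \<Rightarrow>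
   ('e \<Rightarrow> 'e \<Rightarrow> real) \<Rightarrow> bool" where
  "bundle_metric A E g \<longleftrightarrow>
     (\<forall>p. \<forall>u\<in>fibre E p. \<forall>v\<in>fibre E p. g u v = g v u) \<and>
     (\<forall>p. \<forall>u\<in>fibre E p. \<forall>v\<in>fibre E p. \<forall>w\<in>fibre E p. g (fadd E u v) w = g u w + g v w) \<and>
     (\<forall>p c. \<forall>u\<in>fibre E p. \<forall>w\<in>fibre E p. g (fscale E c u) w = c * g u w) \<and>
     (\<forall>p. \<forall>u\<in>fibre E p. (\<forall>v\<in>fibre E p. g u v = 0) \<longrightarrow> u = fzero E p) \<and>
     (\<forall>(U, \<psi>)\<in>trivs E. \<forall>w w'. smooth_map_on A U (\<lambda>p. g (triv_inv E \<psi> p w) (triv_inv E \<psi> p w')))"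

text \<open>A structure is a pair \<open>(\<rho>, [\<cdot>,\<cdot>])\<close>; the bracket matters on smooth sections only.\<close>

type_synonym ('m, 'e) cstruct =
  "('e \<Rightarrow> 'm tangent) \<times> (('m \<Rightarrow> 'e) \<Rightarrow> ('m \<Rightarrow> 'e) \<Rightarrow> ('m \<Rightarrow> 'e))"

definition pair_sec :: "('e \<Rightarrow> 'e \<Rightarrow> real) \<Rightarrow> ('m \<Rightarrow> 'e) \<Rightarrow> ('m \<Rightarrow> 'e) \<Rightarrow> 'm \<Rightarrow> real" where
  "pair_sec g X Y = (\<lambda>p. g (X p) (Y p))"

definition anchor_deriv :: "('e \<Rightarrow> 'm tangent) \<Rightarrow> ('m \<Rightarrow> 'e) \<Rightarrow> ('m \<Rightarrow> real) \<Rightarrow> 'm \<Rightarrow> real" where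
  "anchor_deriv \<rho> X f = (\<lambda>p. snd (\<rho> (X p)) f)"

definition pre_courant_structure ::
  "('m, 'n::real_normed_vector) atlas \<Rightarrow> ('m, 'e, 'f::real_normed_vector) vbundle \<Rightarrow>
   ('e \<Rightarrow> 'e \<Rightarrow> real) \<Rightarrow> ('m, 'e) cstruct \<Rightarrow> bool" where
  "pre_courant_structure A E g \<Theta> \<longleftrightarrow> (case \<Theta> of (\<rho>, br) \<Rightarrow>
     bundle_map A E (tangent_bundle A) \<rho> \<and>
     (\<forall>X\<in>sections A E. \<forall>Y\<in>sections A E. br X Y \<in> sections A E) \<and>
     (\<forall>X\<in>sections A E. \<forall>Y\<in>sections A E. \<forall>Z\<in>sections A E.
        br (sec_add E X Y) Z = sec_add E (br X Z) (br Y Z) \<and>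
        br Z (sec_add E X Y) = sec_add E (br Z X) (br Z Y)) \<and>
     (\<forall>c. \<forall>X\<in>sections A E. \<forall>Y\<in>sections A E.
        br (sec_scale E c X) Y = sec_scale E c (br X Y) \<and>
        br X (sec_scale E c Y) = sec_scale E c (br X Y)) \<and>
     (\<forall>X\<in>sections A E. \<forall>Y\<in>sections A E. \<forall>Z\<in>sections A E.
        anchor_deriv \<rho> X (pair_sec g Y Z) =
          (\<lambda>p. pair_sec g (br X Y) Z p + pair_sec g Y (br X Z) p) \<and>
        anchor_deriv \<rho> X (pair_sec g Y Z) =
          pair_sec g X (sec_add E (br Y Z) (br Z Y))))"

definition pre_courant_algebroid ::
  "('m::{t2_space, second_countable_topology}, 'n::real_normed_vector) atlas \<Rightarrow>
   ('m, 'e, 'f::real_normed_vector) vbundle \<Rightarrow>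
   ('e \<Rightarrow> 'e \<Rightarrow> real) \<Rightarrow> ('m, 'e) cstruct \<Rightarrow> bool" where
  "pre_courant_algebroid A E g \<Theta> \<longleftrightarrow>
     smooth_manifold A \<and> vector_bundle A E \<and> bundle_metric A E g \<and> pre_courant_structure A E g \<Theta>"

definition struct_add ::
  "('m, 'n::real_normed_vector) atlas \<Rightarrow> ('m, 'e, 'f) vbundle \<Rightarrow>
   ('m, 'e) cstruct \<Rightarrow> ('m, 'e) cstruct \<Rightarrow> ('m, 'e) cstruct" where
  "struct_add A E \<Theta> \<Theta>' =
     ((\<lambda>e. fadd (tangent_bundle A) (fst \<Theta> e) (fst \<Theta>' e)),
      (\<lambda>X Y. sec_add E (snd \<Theta> X Y) (snd \<Theta>' X Y)))"

definition struct_is_zero ::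
  "('m, 'n::real_normed_vector) atlas \<Rightarrow> ('m, 'e, 'f::real_normed_vector) vbundle \<Rightarrow>
   ('m, 'e) cstruct \<Rightarrow> bool" where
  "struct_is_zero A E \<Theta> \<longleftrightarrow>
     (\<forall>e\<in>tot_space E. fst \<Theta> e = fzero (tangent_bundle A) (bproj E e)) \<and>
     (\<forall>X\<in>sections A E. \<forall>Y\<in>sections A E. snd \<Theta> X Y = fzero E)"


section \<open>(1,1)-tensors\<close>

abbreviation tensor11 ::
  "('m, 'n::real_normed_vector) atlas \<Rightarrow> ('m, 'e, 'f::real_normed_vector) vbundle \<Rightarrow>
   ('e \<Rightarrow> 'e) \<Rightarrow> bool" where
  "tensor11 A E J \<equiv> bundle_map A E E J"

definition tensor_add :: "('m, 'e, 'f) vbundle \<Rightarrow> ('e \<Rightarrow> 'e) \<Rightarrow> ('e \<Rightarrow> 'e) \<Rightarrow> 'e \<Rightarrow> 'e" where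
  "tensor_add E J J' = (\<lambda>e. fadd E (J e) (J' e))"

definition tensor_scale :: "('m, 'e, 'f) vbundle \<Rightarrow> real \<Rightarrow> ('e \<Rightarrow> 'e) \<Rightarrow> 'e \<Rightarrow> 'e" where
  "tensor_scale E c J = (\<lambda>e. fscale E c (J e))"

definition skew_tensor ::
  "('m, 'n::real_normed_vector) atlas \<Rightarrow> ('m, 'e, 'f::real_normed_vector) vbundle \<Rightarrow>
   ('e \<Rightarrow> 'e \<Rightarrow> real) \<Rightarrow> ('e \<Rightarrow> 'e) \<Rightarrow> bool" where
  "skew_tensor A E g J \<longleftrightarrow> tensor11 A E J \<and>
     (\<forall>p. \<forall>u\<in>fibre E p. \<forall>v\<in>fibre E p. g (J u) v + g u (J v) = 0)"

text \<open>\<open>{J, I} = I \<circ> J - J \<circ> I\<close>; note the order.\<close>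

definition tensor_bracket :: "('m, 'e, 'f) vbundle \<Rightarrow> ('e \<Rightarrow> 'e) \<Rightarrow> ('e \<Rightarrow> 'e) \<Rightarrow> 'e \<Rightarrow> 'e" where
  "tensor_bracket E J I = tensor_add E (I \<circ> J) (tensor_scale E (- 1) (J \<circ> I))"

definition deform :: "('m, 'e, 'f) vbundle \<Rightarrow> ('m, 'e) cstruct \<Rightarrow> ('e \<Rightarrow> 'e) \<Rightarrow> ('m, 'e) cstruct" where
  "deform E \<Theta> J = (case \<Theta> of (\<rho>, br) \<Rightarrow>
     (\<rho> \<circ> J,
      \<lambda>X Y. sec_diff E (sec_add E (br (J \<circ> X) Y) (br X (J \<circ> Y))) (J \<circ> br X Y)))"

primrec deform_iter ::
  "('m, 'e, 'f) vbundle \<Rightarrow> ('m, 'e) cstruct \<Rightarrow> ('e \<Rightarrow> 'e) \<Rightarrow> nat \<Rightarrow> ('m, 'e) cstruct" where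
  "deform_iter E \<Theta> I 0 = \<Theta>"
| "deform_iter E \<Theta> I (Suc k) = deform E (deform_iter E \<Theta> I k) I"

definition nijenhuis ::
  "('m, 'n::real_normed_vector) atlas \<Rightarrow> ('m, 'e, 'f::real_normed_vector) vbundle \<Rightarrow>
   ('m, 'e) cstruct \<Rightarrow> ('e \<Rightarrow> 'e) \<Rightarrow> bool" where
  "nijenhuis A E \<Theta> I \<longleftrightarrow> tensor11 A E I \<and>
     (\<forall>X\<in>sections A E. \<forall>Y\<in>sections A E.
        sec_diff E (snd \<Theta> (I \<circ> X) (I \<circ> Y)) (I \<circ> snd (deform E \<Theta> I) X Y) = fzero E)"

definition poisson_tensor ::
  "('m, 'n::real_normed_vector) atlas \<Rightarrow> ('m, 'e, 'f::real_normed_vector) vbundle \<Rightarrow>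
   ('e \<Rightarrow> 'e \<Rightarrow> real) \<Rightarrow> ('m, 'e) cstruct \<Rightarrow> ('e \<Rightarrow> 'e) \<Rightarrow> bool" where
  "poisson_tensor A E g \<Theta> J \<longleftrightarrow>
     skew_tensor A E g J \<and> struct_is_zero A E (deform E (deform E \<Theta> J) J)"

definition compatible_poisson ::
  "('m, 'n::real_normed_vector) atlas \<Rightarrow> ('m, 'e, 'f::real_normed_vector) vbundle \<Rightarrow>
   ('e \<Rightarrow> 'e \<Rightarrow> real) \<Rightarrow> ('m, 'e) cstruct \<Rightarrow> ('e \<Rightarrow> 'e) \<Rightarrow> ('e \<Rightarrow> 'e) \<Rightarrow> bool" where
  "compatible_poisson A E g \<Theta> J J' \<longleftrightarrow>
     poisson_tensor A E g \<Theta> J \<and> poisson_tensor A E g \<Theta> J' \<and>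
     poisson_tensor A E g \<Theta> (tensor_add E J J')"

definition concomitant ::
  "('m, 'n::real_normed_vector) atlas \<Rightarrow> ('m, 'e, 'f) vbundle \<Rightarrow>
   ('m, 'e) cstruct \<Rightarrow> ('e \<Rightarrow> 'e) \<Rightarrow> ('e \<Rightarrow> 'e) \<Rightarrow> ('m, 'e) cstruct" where
  "concomitant A E \<Theta> I J =
     struct_add A E (deform E (deform E \<Theta> I) J) (deform E (deform E \<Theta> J) I)"

definition compatible_pair ::
  "('m, 'n::real_normed_vector) atlas \<Rightarrow> ('m, 'e, 'f::real_normed_vector) vbundle \<Rightarrow>
   ('e \<Rightarrow> 'e \<Rightarrow> real) \<Rightarrow> ('m, 'e) cstruct \<Rightarrow> ('e \<Rightarrow> 'e) \<Rightarrow> ('e \<Rightarrow> 'e) \<Rightarrow> bool" where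
  "compatible_pair A E g \<Theta> I J \<longleftrightarrow>
     skew_tensor A E g I \<and> skew_tensor A E g J \<and>
     (\<forall>e\<in>tot_space E. (I \<circ> J) e = tensor_scale E (- 1) (J \<circ> I) e) \<and>
     struct_is_zero A E (concomitant A E \<Theta> I J)"

definition poisson_nijenhuis_pair ::
  "('m, 'n::real_normed_vector) atlas \<Rightarrow> ('m, 'e, 'f::real_normed_vector) vbundle \<Rightarrow>
   ('e \<Rightarrow> 'e \<Rightarrow> real) \<Rightarrow> ('m, 'e) cstruct \<Rightarrow> ('e \<Rightarrow> 'e) \<Rightarrow> ('e \<Rightarrow> 'e) \<Rightarrow> bool" where
  "poisson_nijenhuis_pair A E g \<Theta> J I \<longleftrightarrow>
     compatible_pair A E g \<Theta> J I \<and> poisson_tensor A E g \<Theta> J \<and> nijenhuis A E \<Theta> I"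

end

theory Submission
  imports Defs "HOL-Library.Function_Algebras"
begin

text \<open>
  Write \<open>D\<^sub>A\<close> for the deformation of a bracket by an endomorphism \<open>A\<close>. Then
  \<open>D\<^sub>B D\<^sub>A - D\<^sub>A D\<^sub>B = D\<^sub>C\<close> with \<open>C = A B - B A\<close>, so the theorem becomes a computation with the operators
  \<open>D\<^sub>I\<close> and \<open>D\<^sub>J\<close> on biadditive brackets. If the torsion of \<open>I\<close> vanishes on \<open>\<phi>\<close> and
  \<open>D\<^sub>I D\<^sub>J \<phi> = - D\<^sub>J D\<^sub>I \<phi>\<close>, then both properties pass to \<open>D\<^sub>I \<phi>\<close>, and deforming \<open>\<phi>\<close> by \<open>I\<^sup>n J\<close> yields
  \<open>D\<^sub>J D\<^sub>I\<^sup>n \<phi>\<close>. The condition on \<open>{J,{I,J}} = - 4 I J\<^sup>2\<close> is what makes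
  \<open>D\<^sub>J\<^sup>2 \<phi> = 0\<close> pass to \<open>D\<^sub>I \<phi>\<close>; it then follows that \<open>D\<^sub>J \<phi>\<close> also satisfies the two properties, hence
  that any two deformations by members of the hierarchy compose to zero on \<open>D\<^sub>I\<^sup>k \<phi>\<close>.
  Sections are identified with functions into the model fibre by choosing a trivialization at every
  point separately.
\<close>

section \<open>Deformations of biadditive brackets\<close>

lemma funpow_Suc_swap: "(f ^^ Suc n) x = (f ^^ n) (f x)"
  by (simp add: funpow_swap1)

text \<open>Sections will become functions into the model fibre, and the smooth ones form a subgroup
  \<open>S\<close> of all such functions. Working with a subgroup of a group type keeps all maps
  total. Group structure is enough because the deformation formula has no scalars other than
  signs.\<close>

locale additive_carrier =
  fixes S :: "'v::ab_group_add set"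
  assumes zero_closed: "0 \<in> S"
    and add_closed: "x \<in> S \<Longrightarrow> y \<in> S \<Longrightarrow> x + y \<in> S"
    and uminus_closed: "x \<in> S \<Longrightarrow> - x \<in> S"
begin

text \<open>Additivity is required on the whole type, closure on \<open>S\<close> alone. Coordinate
  forms of bundle maps act pointwise and are additive on all functions, so that rewriting with
  \<open>endo_add\<close> produces no membership conditions.\<close>

definition endo :: "('v \<Rightarrow> 'v) \<Rightarrow> bool" where
  "endo A \<longleftrightarrow> (\<forall>x y. A (x + y) = A x + A y) \<and> (\<forall>x\<in>S. A x \<in> S)"

text \<open>The value 0 outside \<open>S\<close> makes equality of brackets the same as equality on
  \<open>S\<close>, so that identities between deformations become equations between
  functions.\<close>

definition brackets :: "('v \<Rightarrow> 'v \<Rightarrow> 'v) set" where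
  "brackets = {\<phi>. (\<forall>x y. x \<notin> S \<or> y \<notin> S \<longrightarrow> \<phi> x y = 0) \<and>
     (\<forall>x\<in>S. \<forall>y\<in>S. \<forall>z\<in>S. \<phi> (x + y) z = \<phi> x z + \<phi> y z \<and> \<phi> z (x + y) = \<phi> z x + \<phi> z y)}"

definition D :: "('v \<Rightarrow> 'v) \<Rightarrow> ('v \<Rightarrow> 'v \<Rightarrow> 'v) \<Rightarrow> 'v \<Rightarrow> 'v \<Rightarrow> 'v" where
  "D A \<phi> = (\<lambda>x y. if x \<in> S \<and> y \<in> S then \<phi> (A x) y + \<phi> x (A y) - A (\<phi> x y) else 0)"

definition torsion :: "('v \<Rightarrow> 'v) \<Rightarrow> ('v \<Rightarrow> 'v) \<Rightarrow> ('v \<Rightarrow> 'v \<Rightarrow> 'v) \<Rightarrow> 'v \<Rightarrow> 'v \<Rightarrow> 'v" where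
  "torsion A B \<phi> = (\<lambda>x y. if x \<in> S \<and> y \<in> S
     then \<phi> (A x) (B y) - A (\<phi> x (B y)) - B (\<phi> (A x) y) + A (B (\<phi> x y)) else 0)"

section \<open>Calculation rules for endomorphisms and biadditive brackets\<close>

lemma diff_closed: "x \<in> S \<Longrightarrow> y \<in> S \<Longrightarrow> x - y \<in> S"
  using add_closed[of x "- y"] uminus_closed[of y] by simp

lemma endo_add: "endo A \<Longrightarrow> A (x + y) = A x + A y"
  and endo_closed: "endo A \<Longrightarrow> x \<in> S \<Longrightarrow> A x \<in> S"
  by (auto simp: endo_def)

lemma endo_zero: "endo A \<Longrightarrow> A 0 = 0"
  using endo_add[of A 0 0] by simp

lemma endo_uminus: "endo A \<Longrightarrow> A (- x) = - A x"
  using endo_add[of A x "- x"] by (simp add: endo_zero eq_neg_iff_add_eq_0 add.commute)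

lemma endo_diff: "endo A \<Longrightarrow> A (x - y) = A x - A y"
  using endo_add[of A x "- y"] by (simp add: endo_uminus)

lemmas endo_simps = endo_add endo_closed endo_zero endo_uminus endo_diff

lemma endo_comp: "endo A \<Longrightarrow> endo B \<Longrightarrow> endo (A \<circ> B)"
  by (simp add: endo_def)

lemma endo_id: "endo id"
  by (simp add: endo_def)

lemma endo_funpow: "endo A \<Longrightarrow> endo (A ^^ n)"
  by (induction n) (auto simp: endo_id endo_comp)

lemma br_outside: "\<phi> \<in> brackets \<Longrightarrow> x \<notin> S \<or> y \<notin> S \<Longrightarrow> \<phi> x y = 0"
  by (auto simp: brackets_def)

lemma br_add:
  assumes "\<phi> \<in> brackets" "x \<in> S" "y \<in> S" "z \<in> S"
  shows "\<phi> (x + y) z = \<phi> x z + \<phi> y z" "\<phi> z (x + y) = \<phi> z x + \<phi> z y"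
  using assms by (auto simp: brackets_def)

lemma br_zero:
  assumes "\<phi> \<in> brackets" "z \<in> S"
  shows "\<phi> 0 z = 0" "\<phi> z 0 = 0"
  using br_add[OF assms(1) zero_closed zero_closed assms(2)] by simp_all

lemma br_uminus:
  assumes "\<phi> \<in> brackets" "x \<in> S" "z \<in> S"
  shows "\<phi> (- x) z = - \<phi> x z" "\<phi> z (- x) = - \<phi> z x"
  using br_add[OF assms(1) assms(2) uminus_closed[OF assms(2)] assms(3)] br_zero[OF assms(1,3)]
  by (simp_all add: eq_neg_iff_add_eq_0 add.commute)

lemma br_diff:
  assumes "\<phi> \<in> brackets" "x \<in> S" "y \<in> S" "z \<in> S"
  shows "\<phi> (x - y) z = \<phi> x z - \<phi> y z" "\<phi> z (x - y) = \<phi> z x - \<phi> z y"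
  using br_add[OF assms(1,2) uminus_closed[OF assms(3)] assms(4)] br_uminus[OF assms(1,3,4)]
  by simp_all

lemmas br_simps = br_add br_zero br_uminus br_diff

lemma bracketsI:
  assumes "\<And>x y. x \<notin> S \<or> y \<notin> S \<Longrightarrow> \<phi> x y = 0"
    and "\<And>x y z. x \<in> S \<Longrightarrow> y \<in> S \<Longrightarrow> z \<in> S \<Longrightarrow> \<phi> (x + y) z = \<phi> x z + \<phi> y z"
    and "\<And>x y z. x \<in> S \<Longrightarrow> y \<in> S \<Longrightarrow> z \<in> S \<Longrightarrow> \<phi> z (x + y) = \<phi> z x + \<phi> z y"
  shows "\<phi> \<in> brackets"
  using assms by (auto simp: brackets_def)

lemma D_brackets [simp]:
  assumes "endo A" "\<phi> \<in> brackets"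
  shows "D A \<phi> \<in> brackets"
  using assms by (intro bracketsI) (auto simp: D_def endo_simps add_closed br_simps algebra_simps)

lemma add_brackets [simp]: "\<phi> \<in> brackets \<Longrightarrow> \<psi> \<in> brackets \<Longrightarrow> \<phi> + \<psi> \<in> brackets"
  by (simp add: brackets_def algebra_simps)

lemma D_funpow_brackets [simp]: "endo A \<Longrightarrow> \<phi> \<in> brackets \<Longrightarrow> (D A ^^ n) \<phi> \<in> brackets"
  by (induction n) auto

section \<open>Algebra of the deformation operators and of the torsion\<close>

lemma D_zero: "endo A \<Longrightarrow> D A 0 = 0"
  by (auto simp: D_def endo_simps fun_eq_iff)

lemma D_uminus: "endo A \<Longrightarrow> D A (- \<phi>) = - D A \<phi>"
  by (auto simp: D_def endo_simps fun_eq_iff)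

lemma D_plus: "endo A \<Longrightarrow> D A (\<phi> + \<psi>) = D A \<phi> + D A \<psi>"
  by (auto simp: D_def endo_simps fun_eq_iff)

lemma D_plus_endo: "\<phi> \<in> brackets \<Longrightarrow> endo A \<Longrightarrow> endo B \<Longrightarrow> D (A + B) \<phi> = D A \<phi> + D B \<phi>"
  by (auto simp: D_def endo_simps fun_eq_iff br_simps)

text \<open>The operator \<open>- D A\<close> is the natural action of the Lie algebra of
  endomorphisms on biadditive maps, which sends commutators to commutators. The minus sign accounts
  for the order of \<open>A\<close> and \<open>B\<close> in the last term.\<close>

lemma D_commutator:
  assumes "\<phi> \<in> brackets" "endo A" "endo B"
  shows "D B (D A \<phi>) = D A (D B \<phi>) + D ((A \<circ> B) - (B \<circ> A)) \<phi>"
  using assms by (auto simp: D_def fun_eq_iff endo_simps br_simps algebra_simps)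

text \<open>The torsion is built naturally from \<open>I\<close> and \<phi>. The infinitesimal
  action of \<open>A\<close> leaves \<open>I\<close> unchanged when the two commute, so only \<phi>
  gets deformed. With \<open>A = I\<close> it follows that vanishing torsion passes to
  \<open>D I \<phi>\<close>.\<close>

lemma torsion_D:
  assumes "\<phi> \<in> brackets" "endo A" "endo I" "A \<circ> I = I \<circ> A"
  shows "torsion I I (D A \<phi>) = D A (torsion I I \<phi>)"
proof -
  have "A (I x) = I (A x)" for x
    using assms(4) by (metis comp_apply)
  then show ?thesis
    using assms by (auto simp: D_def torsion_def fun_eq_iff endo_simps br_simps algebra_simps)
qed

text \<open>The second exponent is raised first, with first map \<open>I\<close>, and then the first
  exponent. Each step expresses the torsion at the higher power as the one at the lower power, with
  one argument moved by \<open>I\<close>, plus a power of \<open>I\<close> applied to a torsion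
  already known to vanish.\<close>

lemma torsion_funpow:
  assumes "\<phi> \<in> brackets" "endo I" "torsion I I \<phi> = 0"
  shows "torsion (I ^^ p) (I ^^ q) \<phi> = 0"
proof -
  have pow: "endo (I ^^ n)" for n
    using assms(2) by (rule endo_funpow)
  have com: "(I ^^ n) (I z) = I ((I ^^ n) z)" for n z
    by (simp add: funpow_swap1)
  have one: "torsion I (I ^^ q) \<phi> x y = 0" if "x \<in> S" "y \<in> S" for q x y
    using that
  proof (induction q arbitrary: y)
    case 0
    then show ?case by (simp add: torsion_def)
  next
    case (Suc q)
    have "torsion I (I ^^ Suc q) \<phi> x y
      = torsion I (I ^^ q) \<phi> x (I y) + (I ^^ q) (torsion I I \<phi> x y)"
      using Suc.prems assms(1,2) pow
      by (simp add: torsion_def endo_simps com algebra_simps)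
    also have "\<dots> = 0"
      using Suc assms(2,3) pow by (simp add: endo_simps)
    finally show ?case .
  qed
  have "torsion (I ^^ p) (I ^^ q) \<phi> x y = 0" if "x \<in> S" "y \<in> S" for x y
    using that
  proof (induction p arbitrary: x)
    case 0
    then show ?case by (simp add: torsion_def)
  next
    case (Suc p)
    have c2: "(I ^^ p) ((I ^^ q) z) = (I ^^ q) ((I ^^ p) z)" for z
      by (metis add.commute comp_apply funpow_add)
    have "torsion (I ^^ Suc p) (I ^^ q) \<phi> x y
      = torsion (I ^^ p) (I ^^ q) \<phi> (I x) y + (I ^^ p) (torsion I (I ^^ q) \<phi> x y)"
      using Suc.prems assms(1,2) pow
      by (simp add: torsion_def endo_simps com c2 algebra_simps)
    also have "\<dots> = 0"
      using Suc assms(2) pow one by (simp add: endo_simps)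
    finally show ?case .
  qed
  then show ?thesis
    by (auto simp: fun_eq_iff torsion_def)
qed

text \<open>In general \<open>D (I ^^ Suc p) \<phi>\<close> differs from
  \<open>D (I ^^ p) (D I \<phi>)\<close> by the mixed torsions of \<open>I ^^ p\<close> and
  \<open>I\<close>, which vanish here. The induction varies \<phi> because its hypothesis is applied
  to \<open>D I \<phi>\<close>.\<close>

lemma D_funpow:
  assumes "\<phi> \<in> brackets" "endo I" "torsion I I \<phi> = 0"
  shows "D (I ^^ p) \<phi> = (D I ^^ p) \<phi>"
  using assms(1,3)
proof (induction p arbitrary: \<phi>)
  case 0
  \<comment> \<open>Deforming by the identity gives \<open>\<phi> + \<phi> - \<phi>\<close> on
    \<open>S\<close>; outside \<open>S\<close> the default 0 of \<open>D\<close> agrees with that of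
    a bracket.\<close>
  then show ?case by (auto simp: D_def fun_eq_iff br_outside)
next
  case (Suc p)
  have pow: "endo (I ^^ p)"
    using assms(2) by (rule endo_funpow)
  have com: "(I ^^ p) (I z) = I ((I ^^ p) z)" for z
    by (simp add: funpow_swap1)
  \<comment> \<open>\<open>I\<close> is written as \<open>I ^^ 1\<close> in the torsions, so that
    both are instances of \<open>torsion_funpow\<close>.\<close>
  have "D (I ^^ Suc p) \<phi>
      = D (I ^^ p) (D I \<phi>) - torsion (I ^^ p) (I ^^ 1) \<phi> - torsion (I ^^ 1) (I ^^ p) \<phi>"
    using Suc.prems assms(2) pow
    by (auto simp: torsion_def D_def fun_eq_iff endo_simps com algebra_simps)
  also have "\<dots> = D (I ^^ p) (D I \<phi>)"
    by (simp add: torsion_funpow[OF Suc.prems(1) assms(2) Suc.prems(2)] del: funpow.simps One_nat_def)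
  also have "\<dots> = (D I ^^ p) (D I \<phi>)"
    using torsion_D[OF Suc.prems(1) assms(2,2) refl] Suc.prems assms(2)
    by (intro Suc.IH) (simp_all only: D_zero D_brackets)
  finally show ?case unfolding funpow_Suc_swap[of p "D I"] .
qed

text \<open>When \<open>J\<close> anticommutes with \<open>I\<close>, the torsion of
  \<open>D J \<phi>\<close> is a combination of torsion values of \<phi> up to an error term. The
  error is \<open>I\<close> applied to \<open>D I (D J \<phi>) + D J (D I \<phi>)\<close>, which the
  last assumption removes.\<close>

lemma torsion_D_anticommuting:
  assumes \<phi>: "\<phi> \<in> brackets" and I: "endo I" and J: "endo J" and anti: "\<And>x. J (I x) = - I (J x)"
    and tors: "torsion I I \<phi> = 0" and conc: "D I (D J \<phi>) + D J (D I \<phi>) = 0"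
  shows "torsion I I (D J \<phi>) = 0"
proof (intro ext)
  fix x y
  show "torsion I I (D J \<phi>) x y = 0 x y"
  proof (cases "x \<in> S \<and> y \<in> S")
    case True
    have "torsion I I (D J \<phi>) x y + I ((D I (D J \<phi>) + D J (D I \<phi>)) x y)
      = - J (torsion I I \<phi> x y) - torsion I I \<phi> (J x) y - torsion I I \<phi> x (J y)"
      using True \<phi> I J
      by (simp add: torsion_def D_def endo_simps br_simps anti algebra_simps)
    then show ?thesis
      using I J by (simp add: tors conc endo_simps)
  qed (auto simp: torsion_def)
qed

end

text \<open>The last two assumptions stand in for division by 2 and by 3. The 2 arises from
  commutators of anticommuting maps, the 3 in \<open>pn_bracket_D_I\<close>.\<close>

locale anticommuting_endos = additive_carrier S for S :: "'v::ab_group_add set" +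
  fixes I J :: "'v \<Rightarrow> 'v"
  assumes endo_I: "endo I" and endo_J: "endo J"
    and anticommute: "J (I x) = - I (J x)"
    and double_zero: "x + x = 0 \<Longrightarrow> (x::'v) = 0"
    and triple_zero: "x + x + x = 0 \<Longrightarrow> (x::'v) = 0"
begin

text \<open>The last clause says that \<open>D I\<close> and \<open>D J\<close> anticommute on
  \<phi> itself, not as operators. To interchange them on a deformed bracket, the property has to be
  established for that bracket first.\<close>

definition pn_compatible :: "('v \<Rightarrow> 'v \<Rightarrow> 'v) \<Rightarrow> bool" where
  "pn_compatible \<phi> \<longleftrightarrow> \<phi> \<in> brackets \<and> torsion I I \<phi> = 0 \<and> D I (D J \<phi>) + D J (D I \<phi>) = 0"

text \<open>The last clause is the hypothesis on \<open>{J, {I, J}}\<close> in coordinates, divided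
  by the factor - 4.\<close>

definition pn_bracket :: "('v \<Rightarrow> 'v \<Rightarrow> 'v) \<Rightarrow> bool" where
  "pn_bracket \<phi> \<longleftrightarrow> pn_compatible \<phi> \<and> D J (D J \<phi>) = 0 \<and> D (I \<circ> (J \<circ> J)) \<phi> = 0"

section \<open>The operators \<open>D I\<close> and \<open>D J\<close> for anticommuting
  \<open>I\<close> and \<open>J\<close>\<close>

lemma double_zero_bracket: "(\<phi> :: 'v \<Rightarrow> 'v \<Rightarrow> 'v) + \<phi> = 0 \<Longrightarrow> \<phi> = 0"
proof (intro ext)
  fix x y assume "\<phi> + \<phi> = 0"
  from fun_cong[OF fun_cong[OF this, of x], of y] have "\<phi> x y + \<phi> x y = 0"
    by simp
  then show "\<phi> x y = 0 x y"
    unfolding zero_fun_apply by (rule double_zero)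
qed

lemma double_eq_bracket:
  fixes \<phi> :: "'v \<Rightarrow> 'v \<Rightarrow> 'v"
  assumes "\<phi> + \<phi> = \<psi> + \<psi>"
  shows "\<phi> = \<psi>"
proof -
  have "(\<phi> - \<psi>) + (\<phi> - \<psi>) = 0"
    by (simp only: add_diff_add[symmetric] assms diff_self)
  then have "\<phi> - \<psi> = 0" by (rule double_zero_bracket)
  then show ?thesis by (simp only: right_minus_eq)
qed

lemma triple_zero_bracket: "(\<phi> :: 'v \<Rightarrow> 'v \<Rightarrow> 'v) + \<phi> + \<phi> = 0 \<Longrightarrow> \<phi> = 0"
proof (intro ext)
  fix x y assume "\<phi> + \<phi> + \<phi> = 0"
  from fun_cong[OF fun_cong[OF this, of x], of y] have "\<phi> x y + \<phi> x y + \<phi> x y = 0"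
    by simp
  then show "\<phi> x y = 0 x y"
    unfolding zero_fun_apply by (rule triple_zero)
qed

lemma endo_IJ: "endo (I ^^ n \<circ> J)"
  by (intro endo_comp endo_funpow endo_I endo_J)

lemma funpow_IJ_I: "(I ^^ n) (J (I x)) = - (I ^^ Suc n) (J x)"
  by (simp add: anticommute endo_uminus[OF endo_funpow[OF endo_I]] funpow_swap1)

text \<open>Since \<open>I ^^ n \<circ> J\<close> anticommutes with \<open>I\<close>, their
  commutator is twice a product up to sign. The equation can therefore be solved for twice
  \<open>D (I ^^ Suc n \<circ> J) \<phi>\<close>, which drives the induction in
  \<open>D_IJ_eq\<close>.\<close>

lemma D_I_IJ:
  assumes "\<phi> \<in> brackets"
  shows "D I (D (I ^^ n \<circ> J) \<phi>)
    = D (I ^^ n \<circ> J) (D I \<phi>) - (D (I ^^ Suc n \<circ> J) \<phi> + D (I ^^ Suc n \<circ> J) \<phi>)"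
proof -
  have "((I ^^ n \<circ> J) \<circ> I) - (I \<circ> (I ^^ n \<circ> J)) = (\<lambda>x. - (I ^^ Suc n \<circ> J) x - (I ^^ Suc n \<circ> J) x)"
    by (auto simp: fun_eq_iff funpow_IJ_I)
  moreover have "D (\<lambda>x. - (I ^^ Suc n \<circ> J) x - (I ^^ Suc n \<circ> J) x) \<phi>
      = - (D (I ^^ Suc n \<circ> J) \<phi> + D (I ^^ Suc n \<circ> J) \<phi>)"
    using assms endo_closed[OF endo_IJ[of "Suc n"]]
    by (auto simp: D_def fun_eq_iff br_simps uminus_closed simp del: funpow.simps comp_apply)
  ultimately show ?thesis
    using D_commutator[OF assms endo_IJ endo_I, of n] by simp
qed

lemma pn_compatibleD:
  assumes "pn_compatible \<phi>"
  shows "\<phi> \<in> brackets" "torsion I I \<phi> = 0" "D J (D I \<phi>) = - D I (D J \<phi>)"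
  using assms by (auto simp: pn_compatible_def eq_neg_iff_add_eq_0 add.commute)

lemma torsion_D_J: "pn_compatible \<phi> \<Longrightarrow> torsion I I (D J \<phi>) = 0"
  by (intro torsion_D_anticommuting) (auto simp: pn_compatible_def endo_I endo_J anticommute)

text \<open>The square of \<open>I\<close> commutes with \<open>J\<close>, hence
  \<open>D (I ^^ 2)\<close> commutes with \<open>D J\<close>. The torsion of \<open>I\<close>
  vanishes on \<phi> and on \<open>D J \<phi>\<close>, so on both of them \<open>D (I ^^ 2)\<close>
  is \<open>D I\<close> applied twice.\<close>

lemma pn_compatible_D_I:
  assumes "pn_compatible \<phi>"
  shows "pn_compatible (D I \<phi>)"
proof -
  note \<phi> = pn_compatibleD[OF assms]
  have J\<phi>: "D J \<phi> \<in> brackets" using \<phi>(1) endo_J by simp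
  have two: "D I (D I \<psi>) = D (I ^^ 2) \<psi>" if "\<psi> \<in> brackets" "torsion I I \<psi> = 0" for \<psi>
    using D_funpow[OF that(1) endo_I that(2), of 2] by (simp add: numeral_2_eq_2)
  have "(J \<circ> I ^^ 2) - (I ^^ 2 \<circ> J) = (\<lambda>x. 0)"
    by (auto simp: fun_eq_iff numeral_2_eq_2 anticommute endo_uminus[OF endo_I])
  moreover have "D (\<lambda>x. 0) \<phi> = 0"
    using \<phi>(1) by (auto simp: D_def fun_eq_iff br_simps)
  ultimately have com: "D (I ^^ 2) (D J \<phi>) = D J (D (I ^^ 2) \<phi>)"
    using D_commutator[OF \<phi>(1) endo_J endo_funpow[OF endo_I], of 2] by simp
  have "D I (D J (D I \<phi>)) = - D I (D I (D J \<phi>))"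
    by (simp add: \<phi>(3) D_uminus[OF endo_I])
  also have "\<dots> = - D J (D I (D I \<phi>))"
    by (simp only: two[OF J\<phi> torsion_D_J[OF assms]] two[OF \<phi>(1,2)] com)
  finally have "D I (D J (D I \<phi>)) + D J (D I (D I \<phi>)) = 0" by simp
  moreover have "torsion I I (D I \<phi>) = 0"
    using torsion_D[OF \<phi>(1) endo_I endo_I refl] \<phi>(2) by (simp only: D_zero[OF endo_I])
  ultimately show ?thesis
    using \<phi>(1) endo_I by (simp only: pn_compatible_def D_brackets simp_thms)
qed

lemma pn_compatible_D_I_funpow: "pn_compatible \<phi> \<Longrightarrow> pn_compatible ((D I ^^ n) \<phi>)"
  by (induction n) (auto intro: pn_compatible_D_I)

text \<open>By \<open>D_I_IJ\<close>, twice the left side is a difference of two terms with index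
  \<open>n\<close>, one at \<open>D I \<phi>\<close> and one at \<phi>. Moving \<open>D I\<close>
  past \<open>D J\<close> changes the sign of the second, so the two add up to twice the right
  side.\<close>

lemma D_IJ_eq:
  assumes "pn_compatible \<phi>"
  shows "D (I ^^ n \<circ> J) \<phi> = D J ((D I ^^ n) \<phi>)"
  using assms
proof (induction n arbitrary: \<phi>)
  case (Suc n)
  note C = pn_compatible_D_I_funpow[OF Suc.prems, of n]
  have "D (I ^^ Suc n \<circ> J) \<phi> + D (I ^^ Suc n \<circ> J) \<phi>
      = D (I ^^ n \<circ> J) (D I \<phi>) - D I (D (I ^^ n \<circ> J) \<phi>)"
    using D_I_IJ[OF pn_compatibleD(1)[OF Suc.prems], of n] by (simp add: algebra_simps)
  also have "D (I ^^ n \<circ> J) (D I \<phi>) = D J ((D I ^^ Suc n) \<phi>)"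
    using Suc.IH[OF pn_compatible_D_I[OF Suc.prems]] by (simp only: funpow_Suc_swap)
  also have "D I (D (I ^^ n \<circ> J) \<phi>) = - D J ((D I ^^ Suc n) \<phi>)"
    unfolding Suc.IH[OF Suc.prems] funpow.simps(2) comp_apply pn_compatibleD(3)[OF C]
    by (rule minus_minus[symmetric])
  finally show ?case unfolding diff_minus_eq_add by (rule double_eq_bracket)
qed simp

lemma pn_bracketD: "pn_bracket \<phi> \<Longrightarrow> pn_compatible \<phi>" "pn_bracket \<phi> \<Longrightarrow> D J (D J \<phi>) = 0"
  by (auto simp: pn_bracket_def)

lemma pn_bracket_D_I:
  assumes "pn_bracket \<phi>"
  shows "pn_bracket (D I \<phi>)"
proof -
  have C: "pn_compatible \<phi>" and JJ: "D J (D J \<phi>) = 0" and IJJ: "D (I \<circ> (J \<circ> J)) \<phi> = 0"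
    using assms by (auto simp: pn_bracket_def)
  note \<phi> = pn_compatibleD[OF C]
  define K where "K = I \<circ> J"
  have K: "endo K" unfolding K_def by (intro endo_comp endo_I endo_J)
  have J\<phi>: "D J \<phi> \<in> brackets" using \<phi>(1) endo_J by simp
  have K\<phi>: "D J (D I \<phi>) = D K \<phi>"
    using D_IJ_eq[OF C, of 1] by (simp add: K_def)
  have endo_IJJ: "endo (I \<circ> (J \<circ> J))" by (intro endo_comp endo_I endo_J)
  \<comment> \<open>The commutator of \<open>J\<close> and \<open>K\<close> is - 2 times
    \<open>I \<circ> (J \<circ> J)\<close>, so the condition on the latter makes \<open>D J\<close>
    and \<open>D K\<close> commute on \<phi>.\<close>
  have "(J \<circ> K) - (K \<circ> J) = (\<lambda>x. - (I \<circ> (J \<circ> J)) x - (I \<circ> (J \<circ> J)) x)"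
    by (auto simp: fun_eq_iff K_def anticommute)
  moreover have "D (\<lambda>x. - (I \<circ> (J \<circ> J)) x - (I \<circ> (J \<circ> J)) x) \<phi>
      = - (D (I \<circ> (J \<circ> J)) \<phi> + D (I \<circ> (J \<circ> J)) \<phi>)"
    using \<phi>(1) endo_closed[OF endo_IJJ]
    by (auto simp: D_def fun_eq_iff br_simps uminus_closed simp del: comp_apply)
  ultimately have JK: "D K (D J \<phi>) = D J (D K \<phi>)"
    using D_commutator[OF \<phi>(1) endo_J K] IJJ by simp
  \<comment> \<open>The left side is 0. On the right, the first term is minus
    \<open>D J (D K \<phi>)\<close> and the subtracted pair contributes two more copies. Hence three
    copies vanish, and \<open>D K \<phi>\<close> is \<open>D J (D I \<phi>)\<close>.\<close>
  have "D I (D J (D J \<phi>)) = D J (D I (D J \<phi>)) - (D K (D J \<phi>) + D K (D J \<phi>))"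
    using D_I_IJ[OF J\<phi>, of 0] by (simp add: K_def)
  moreover have "D I (D J \<phi>) = - D K \<phi>"
    using \<phi>(3) K\<phi> by (metis add.inverse_inverse)
  ultimately have "D J (D K \<phi>) + D J (D K \<phi>) + D J (D K \<phi>) = 0"
    by (simp add: JJ JK D_zero[OF endo_I] D_uminus[OF endo_J] algebra_simps eq_neg_iff_add_eq_0)
  then have "D J (D J (D I \<phi>)) = 0"
    unfolding K\<phi> by (rule triple_zero_bracket)
  moreover have "D (I \<circ> (J \<circ> J)) (D I \<phi>) = 0"
  proof -
    \<comment> \<open>\<open>I\<close> commutes with \<open>I \<circ> (J \<circ> J)\<close>, because
      passing it through \<open>J\<close> twice cancels the signs.\<close>
    have "((I \<circ> (J \<circ> J)) \<circ> I) - (I \<circ> (I \<circ> (J \<circ> J))) = (\<lambda>x. 0)"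
      by (auto simp: fun_eq_iff anticommute endo_uminus[OF endo_I] endo_uminus[OF endo_J])
    moreover have "D (\<lambda>x. 0) \<phi> = 0"
      using \<phi>(1) by (auto simp: D_def fun_eq_iff br_simps)
    ultimately show ?thesis
      using D_commutator[OF \<phi>(1) endo_IJJ endo_I] IJJ by (simp add: D_zero[OF endo_I])
  qed
  ultimately show ?thesis
    using pn_compatible_D_I[OF C] by (simp add: pn_bracket_def)
qed

lemma pn_bracket_D_I_funpow: "pn_bracket \<phi> \<Longrightarrow> pn_bracket ((D I ^^ n) \<phi>)"
  by (induction n) (auto intro: pn_bracket_D_I)

text \<open>Both terms of the anticommutator vanish separately on \<open>D J \<phi>\<close>: one by
  \<open>D J (D J \<phi>) = 0\<close>, the other by the same equation for \<open>D I \<phi>\<close>,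
  which \<open>pn_bracket_D_I\<close> supplies.\<close>

lemma pn_compatible_D_J:
  assumes "pn_bracket \<phi>"
  shows "pn_compatible (D J \<phi>)"
proof -
  note C = pn_bracketD(1)[OF assms]
  have "D J (D I (D J \<phi>)) = - D J (D J (D I \<phi>))"
    using pn_compatibleD(3)[OF C] by (simp add: D_uminus[OF endo_J])
  then have "D J (D I (D J \<phi>)) = 0"
    using pn_bracketD(2)[OF pn_bracket_D_I[OF assms]] by simp
  then show ?thesis
    using torsion_D_J[OF C] pn_bracketD(2)[OF assms] pn_compatibleD(1)[OF C] endo_J
    by (simp add: pn_compatible_def D_zero[OF endo_I])
qed

text \<open>Each step moves the innermost \<open>D I\<close> inside \<open>D J\<close> at the cost
  of a sign. This replaces \<phi> by \<open>D I \<phi>\<close>, again a \<open>pn_bracket\<close>,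
  until \<open>D J\<close> meets \<open>D J\<close>.\<close>

lemma D_J_funpow_D_J:
  assumes "pn_bracket \<phi>"
  shows "D J ((D I ^^ n) (D J \<phi>)) = 0"
  using assms
proof (induction n arbitrary: \<phi>)
  case 0
  then show ?case by (simp add: pn_bracketD)
next
  case (Suc n)
  have neg: "(D I ^^ n) (- \<psi>) = - (D I ^^ n) \<psi>" for \<psi>
    by (induction n) (simp_all only: funpow.simps id_apply comp_apply D_uminus[OF endo_I])
  have "D I (D J \<phi>) = - D J (D I \<phi>)"
    using pn_compatibleD(3)[OF pn_bracketD(1)[OF Suc.prems]] by simp
  then have "D J ((D I ^^ Suc n) (D J \<phi>)) = - D J ((D I ^^ n) (D J (D I \<phi>)))"
    by (simp only: funpow_Suc_swap neg D_uminus[OF endo_J])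
  then show ?case
    using Suc.IH[OF pn_bracket_D_I[OF Suc.prems]] by simp
qed

text \<open>The inner deformation is \<open>D J \<psi>\<close> with
  \<open>\<psi> = (D I ^^ n) \<phi>\<close>. As \<open>D J \<psi>\<close> is
  \<open>pn_compatible\<close>, the outer one equals \<open>D J ((D I ^^ m) (D J \<psi>))\<close>,
  which is 0.\<close>

theorem D_IJ_D_IJ:
  assumes "pn_bracket \<phi>"
  shows "D (I ^^ m \<circ> J) (D (I ^^ n \<circ> J) \<phi>) = 0"
proof -
  note Q = pn_bracket_D_I_funpow[OF assms, of n]
  show ?thesis
    by (simp add: D_IJ_eq[OF pn_bracketD(1)[OF assms]] D_IJ_eq[OF pn_compatible_D_J[OF Q]]
        D_J_funpow_D_J[OF Q])
qed

lemma D_I_even_D_J: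
  assumes "pn_compatible \<phi>"
  shows "(D I ^^ (2 * m)) (D J \<phi>) = D J ((D I ^^ (2 * m)) \<phi>)"
proof (induction m)
  case (Suc m)
  note C = pn_compatible_D_I_funpow[OF assms, of "2 * m"]
  have "(D I ^^ (2 * Suc m)) (D J \<phi>) = D I (D I (D J ((D I ^^ (2 * m)) \<phi>)))"
    using Suc by simp
  also have "\<dots> = - D I (D J (D I ((D I ^^ (2 * m)) \<phi>)))"
    by (simp add: pn_compatibleD(3)[OF C] D_uminus[OF endo_I])
  also have "\<dots> = D J (D I (D I ((D I ^^ (2 * m)) \<phi>)))"
    by (simp add: pn_compatibleD(3)[OF pn_compatible_D_I[OF C]])
  finally show ?case by simp
qed simp

text \<open>Both terms reduce to \<open>D J\<close> of the same iterate of \<open>D I\<close> on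
  \<phi>. Moving an odd number of operators \<open>D I\<close> past \<open>D J\<close> leaves one
  minus sign, so they cancel.\<close>

theorem D_I_odd_D_IJ:
  assumes "pn_bracket \<phi>"
  shows "D (I ^^ n \<circ> J) (D (I ^^ (2 * m + 1)) \<phi>) + D (I ^^ (2 * m + 1)) (D (I ^^ n \<circ> J) \<phi>) = 0"
proof -
  note C = pn_bracketD(1)[OF assms]
  note Cn = pn_compatible_D_I_funpow[OF C, of n]
  note Cm = pn_compatible_D_I_funpow[OF C, of "2 * m + 1"]
  note Cnm = pn_compatible_D_I_funpow[OF Cn, of "2 * m"]
  have "D (I ^^ (2 * m + 1)) (D (I ^^ n \<circ> J) \<phi>) = (D I ^^ (2 * m + 1)) (D J ((D I ^^ n) \<phi>))"
    unfolding D_IJ_eq[OF C] using pn_compatibleD(1)[OF Cn] endo_J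
    by (intro D_funpow endo_I torsion_D_J[OF Cn] D_brackets)
  also have "\<dots> = D I (D J ((D I ^^ (2 * m)) ((D I ^^ n) \<phi>)))"
    by (simp add: D_I_even_D_J[OF Cn])
  also have "\<dots> = - D J (D I ((D I ^^ (2 * m)) ((D I ^^ n) \<phi>)))"
    by (simp add: pn_compatibleD(3)[OF Cnm])
  also have "D I ((D I ^^ (2 * m)) ((D I ^^ n) \<phi>)) = (D I ^^ (2 * m + 1 + n)) \<phi>"
    by (simp add: funpow_add)
  finally have 1: "D (I ^^ (2 * m + 1)) (D (I ^^ n \<circ> J) \<phi>) = - D J ((D I ^^ (2 * m + 1 + n)) \<phi>)" .
  have "D (I ^^ n \<circ> J) (D (I ^^ (2 * m + 1)) \<phi>) = D J ((D I ^^ n) ((D I ^^ (2 * m + 1)) \<phi>))"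
    unfolding D_funpow[OF pn_compatibleD(1)[OF C] endo_I pn_compatibleD(2)[OF C]] by (rule D_IJ_eq[OF Cm])
  also have "(D I ^^ n) ((D I ^^ (2 * m + 1)) \<phi>) = (D I ^^ (2 * m + 1 + n)) \<phi>"
    by (metis add.commute comp_apply funpow_add)
  finally show ?thesis unfolding 1 by (simp only: right_minus)
qed

end

lemma double_eq_zero_real_vector: "x + x = 0 \<Longrightarrow> x = 0" for x :: "'a::real_vector"
  using scaleR_2[of x] by simp

lemma triple_eq_zero_real_vector:
  fixes x :: "'a::real_vector"
  assumes "x + x + x = 0"
  shows "x = 0"
proof -
  have "3 *\<^sub>R x = (1 + 1 + 1) *\<^sub>R x" by simp
  also have "\<dots> = 0" using assms by (simp only: scaleR_add_left scaleR_one)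
  finally show ?thesis by simp
qed


section \<open>Smooth maps with values in finite-dimensional spaces\<close>

text \<open>The bound makes the coefficients of a convergent sequence in the span Cauchy, and their
  limits represent the limit vector.\<close>

lemma closed_span_of_coordinate_bound:
  fixes B :: "'a::real_normed_vector set"
  assumes fin: "finite B"
    and bound: "\<And>c b. b \<in> B \<Longrightarrow> \<bar>c b\<bar> \<le> K * norm (\<Sum>b\<in>B. c b *\<^sub>R b)"
  shows "closed (span B)"
proof -
  have "x \<in> span B" if X: "\<forall>n. X n \<in> span B" and lim: "X \<longlonglongrightarrow> x" for X x
  proof -
    have "\<forall>n. \<exists>c. X n = (\<Sum>b\<in>B. c b *\<^sub>R b)"
      using X fin by (auto simp: span_finite image_iff)
    then obtain c where c: "\<And>n. X n = (\<Sum>b\<in>B. c n b *\<^sub>R b)"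
      by metis
    have "convergent (\<lambda>n. c n b)" if b: "b \<in> B" for b
    proof -
      have K: "\<bar>c n b - c m b\<bar> \<le> K * norm (X n - X m)" for n m
        using bound[of b "\<lambda>b. c n b - c m b"] b
        by (simp add: c scaleR_diff_left sum_subtractf)
      have "Cauchy (\<lambda>n. c n b)"
      proof (rule metric_CauchyI)
        fix e :: real assume "e > 0"
        \<comment> \<open>\<open>\<bar>K\<bar> + 1\<close> replaces \<open>K\<close>, whose sign is
          not fixed here.\<close>
        then have "e / (\<bar>K\<bar> + 1) > 0" by simp
        then obtain M where M: "\<forall>m\<ge>M. \<forall>n\<ge>M. dist (X m) (X n) < e / (\<bar>K\<bar> + 1)"
          using LIMSEQ_imp_Cauchy[OF lim] metric_CauchyD by blast
        have "dist (c m b) (c n b) < e" if "m \<ge> M" "n \<ge> M" for m n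
        proof -
          have "\<bar>c m b - c n b\<bar> \<le> (\<bar>K\<bar> + 1) * norm (X m - X n)"
            by (rule order_trans[OF K]) (intro mult_right_mono, auto)
          also have "\<dots> < e"
            using M that by (simp add: dist_norm pos_less_divide_eq mult.commute)
          finally show ?thesis by (simp add: dist_real_def)
        qed
        then show "\<exists>M. \<forall>m\<ge>M. \<forall>n\<ge>M. dist (c m b) (c n b) < e" by blast
      qed
      then show ?thesis by (simp add: Cauchy_convergent_iff)
    qed
    then have "(\<lambda>n. c n b) \<longlonglongrightarrow> lim (\<lambda>n. c n b)" if "b \<in> B" for b
      using that by (simp add: convergent_LIMSEQ_iff)
    then have "X \<longlonglongrightarrow> (\<Sum>b\<in>B. lim (\<lambda>n. c n b) *\<^sub>R b)"
      unfolding c by (intro tendsto_sum tendsto_scaleR tendsto_const)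
    then have "x = (\<Sum>b\<in>B. lim (\<lambda>n. c n b) *\<^sub>R b)"
      using lim LIMSEQ_unique by blast
    then show ?thesis by (simp add: span_base span_scale span_sum)
  qed
  then show ?thesis by (auto simp: closed_sequential_limits)
qed

text \<open>Induction on the basis. The span of the old vectors is closed by
  \<open>closed_span_of_coordinate_bound\<close>, so the new vector has positive distance from it,
  and this distance controls the new coefficient.\<close>

lemma coordinate_bound:
  fixes B :: "'a::real_normed_vector set"
  assumes "finite B" "independent B"
  shows "\<exists>K\<ge>0. \<forall>c. \<forall>b\<in>B. \<bar>c b\<bar> \<le> K * norm (\<Sum>b\<in>B. c b *\<^sub>R b)"
  using assms
proof (induction B rule: finite_induct)
  case (insert a B)
  then have a: "a \<notin> span B" and "independent B"
    by (auto simp: independent_insert)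
  then obtain K where K: "K \<ge> 0" "\<And>c b. b \<in> B \<Longrightarrow> \<bar>c b\<bar> \<le> K * norm (\<Sum>b\<in>B. c b *\<^sub>R b)"
    using insert.IH by blast
  have "closed (span B)"
    using closed_span_of_coordinate_bound[OF insert.hyps(1) K(2)] .
  define \<delta> where "\<delta> = infdist a (span B)"
  have "\<delta> > 0"
    using a \<open>closed (span B)\<close> infdist_pos_not_in_closed[of "span B" a] span_zero unfolding \<delta>_def by blast
  have ca: "\<bar>c a\<bar> * \<delta> \<le> norm (\<Sum>b\<in>insert a B. c b *\<^sub>R b)" for c
  proof (cases "c a = 0")
    case False
    define s where "s = (\<Sum>b\<in>B. c b *\<^sub>R b)"
    have "s \<in> span B" unfolding s_def by (simp add: span_base span_scale span_sum)
    then have "\<delta> \<le> dist a (- inverse (c a) *\<^sub>R s)"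
      unfolding \<delta>_def by (intro infdist_le span_scale)
    then have "\<bar>c a\<bar> * \<delta> \<le> \<bar>c a\<bar> * norm (a + inverse (c a) *\<^sub>R s)"
      by (intro mult_left_mono) (auto simp: dist_norm)
    also have "\<dots> = norm (c a *\<^sub>R (a + inverse (c a) *\<^sub>R s))" by simp
    also have "c a *\<^sub>R (a + inverse (c a) *\<^sub>R s) = (\<Sum>b\<in>insert a B. c b *\<^sub>R b)"
      using insert.hyps False by (simp add: s_def scaleR_add_right)
    finally show ?thesis .
  qed simp
  \<comment> \<open>The term \<open>1 / \<delta>\<close> bounds the coefficient of \<open>a\<close>.
    The other term comes from applying the bound \<open>K\<close> to the vector with its
    \<open>a\<close>-component removed. The sum serves both cases.\<close>
  define L where "L = 1 / \<delta> + K * (1 + norm a / \<delta>)"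
  have "\<bar>c b\<bar> \<le> L * norm (\<Sum>b\<in>insert a B. c b *\<^sub>R b)" if b: "b \<in> insert a B" for c b
  proof -
    define v where "v = (\<Sum>b\<in>insert a B. c b *\<^sub>R b)"
    have cv: "\<bar>c a\<bar> \<le> norm v / \<delta>"
      using ca[of c] \<open>\<delta> > 0\<close> by (simp add: v_def pos_le_divide_eq)
    have nonneg: "0 \<le> K * (1 + norm a / \<delta>) * norm v" "0 \<le> norm v / \<delta>"
      using K(1) \<open>\<delta> > 0\<close> by auto
    have Lv: "L * norm v = norm v / \<delta> + K * (1 + norm a / \<delta>) * norm v"
      by (simp add: L_def algebra_simps)
    show ?thesis
    proof (cases "b = a")
      case True
      show ?thesis unfolding True v_def[symmetric] using cv nonneg Lv by linarith
    next
      case False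
      then have "\<bar>c b\<bar> \<le> K * norm (\<Sum>b\<in>B. c b *\<^sub>R b)" using b K(2) by blast
      also have "(\<Sum>b\<in>B. c b *\<^sub>R b) = v - c a *\<^sub>R a"
        using insert.hyps by (simp add: v_def)
      also have "K * norm (v - c a *\<^sub>R a) \<le> K * (norm v + norm v / \<delta> * norm a)"
        using mult_right_mono[OF cv norm_ge_zero[of a]]
        by (intro mult_left_mono[OF _ K(1)] order_trans[OF norm_triangle_ineq4] add_left_mono) simp
      also have "\<dots> = K * (1 + norm a / \<delta>) * norm v" by (simp add: algebra_simps)
      finally show ?thesis using nonneg Lv unfolding v_def by linarith
    qed
  qed
  moreover have "L \<ge> 0" using K(1) \<open>\<delta> > 0\<close> by (simp add: L_def)
  ultimately show ?case by blast
qed auto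

text \<open>A model space comes with just a norm and a finite spanning set. The bounded coordinate
  functionals obtained here allow smoothness of fibrewise linear maps to be tested on basis
  vectors.\<close>

lemma finite_dim_coordinates:
  assumes "finite_dim TYPE('a::real_normed_vector)"
  obtains B :: "'a::real_normed_vector set" and r :: "'a \<Rightarrow> 'a \<Rightarrow> real"
  where "finite B" "\<And>b. b \<in> B \<Longrightarrow> bounded_linear (r b)" "\<And>x. x = (\<Sum>b\<in>B. r b x *\<^sub>R b)"
proof -
  obtain C :: "'a set" where C: "finite C" "span C = UNIV"
    using assms by (auto simp: finite_dim_def)
  obtain B where B: "B \<subseteq> C" "independent B" "C \<subseteq> span B"
    using maximal_independent_subset[of C] by blast
  have fin: "finite B" using B(1) C(1) finite_subset by blast
  have span: "x \<in> span B" for x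
    using B(3) C(2) span_mono[of C "span B"] by (auto simp: span_span)
  define r where "r b x = representation B x b" for b x
  obtain K where K: "K \<ge> 0" "\<And>c b. b \<in> B \<Longrightarrow> \<bar>c b\<bar> \<le> K * norm (\<Sum>b\<in>B. c b *\<^sub>R b)"
    using coordinate_bound[OF fin B(2)] by blast
  have sum: "(\<Sum>b\<in>B. r b x *\<^sub>R b) = x" for x
    unfolding r_def using sum_representation_eq[OF B(2) span fin order_refl] by blast
  have "bounded_linear (r b)" if "b \<in> B" for b
  proof (rule bounded_linear_intro)
    show "norm (r b x) \<le> norm x * K" for x
      using K(2)[OF that, of "\<lambda>b. r b x"] sum[of x] by (simp add: mult.commute)
  qed (simp_all add: r_def representation_add[OF B(2)] representation_scale[OF B(2)] span)
  then show ?thesis using that[OF fin _ sum[symmetric]] by blast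
qed

section \<open>Calculus of \<open>Ck_on\<close> on open sets\<close>

lemma Ck_on_cong:
  assumes "open S" "\<And>x. x \<in> S \<Longrightarrow> f x = g x" "Ck_on k f S"
  shows "Ck_on k g S"
  using assms(2,3)
proof (induction k arbitrary: f g)
  case 0
  then show ?case using continuous_on_cong[of S S f g] by simp
next
  case (Suc k)
  \<comment> \<open>Openness of \<open>S\<close> enters here: the derivative at a point depends on
    the values in a neighbourhood.\<close>
  have d: "(g has_derivative frechet_derivative f (at x)) (at x)" if "x \<in> S" for x
    using Suc.prems that assms(1)
    by (intro has_derivative_transform_within_open[of f _ x UNIV S g])
      (auto simp: frechet_derivative_works)
  have "frechet_derivative f (at x) = frechet_derivative g (at x)" if "x \<in> S" for x
    by (rule frechet_derivative_at[OF d[OF that]])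
  moreover have "Ck_on k (\<lambda>x. frechet_derivative f (at x) v) S" for v
    using Suc.prems by simp
  ultimately have "Ck_on k (\<lambda>x. frechet_derivative g (at x) v) S" for v
    using Suc.IH[of "\<lambda>x. frechet_derivative f (at x) v" "\<lambda>x. frechet_derivative g (at x) v"] by simp
  then show ?case using differentiableI[OF d] by simp
qed

lemma Ck_on_subset: "Ck_on k f S \<Longrightarrow> T \<subseteq> S \<Longrightarrow> Ck_on k f T"
  by (induction k arbitrary: f) (auto intro: continuous_on_subset)

lemma Ck_on_local:
  assumes "\<And>x. x \<in> S \<Longrightarrow> \<exists>T. open T \<and> x \<in> T \<and> Ck_on k f T"
  shows "Ck_on k f S"
  using assms
proof (induction k arbitrary: f)
  case 0
  show ?case
  proof (simp, intro continuous_at_imp_continuous_on ballI)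
    fix x assume "x \<in> S"
    then obtain T where "open T" "x \<in> T" "continuous_on T f" using 0 by (metis Ck_on.simps(1))
    then show "isCont f x" by (simp add: continuous_on_eq_continuous_at)
  qed
next
  case (Suc k)
  have "f differentiable (at x)" if "x \<in> S" for x
    using Suc.prems[OF that] by auto
  moreover have "Ck_on k (\<lambda>x. frechet_derivative f (at x) v) S" for v
  proof (rule Suc.IH)
    fix x assume "x \<in> S"
    from Suc.prems[OF this] show "\<exists>T. open T \<and> x \<in> T \<and> Ck_on k (\<lambda>x. frechet_derivative f (at x) v) T"
      by auto
  qed
  ultimately show ?case by simp
qed

text \<open>In the product rule each summand keeps an undifferentiated factor, for which one order
  less must be available.\<close>

lemma Ck_on_SucD: "Ck_on (Suc k) f S \<Longrightarrow> Ck_on k f S"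
proof (induction k arbitrary: f)
  case 0
  then show ?case
    by (auto intro!: continuous_at_imp_continuous_on differentiable_imp_continuous_within)
next
  case (Suc k)
  then show ?case by (metis Ck_on.simps(2))
qed

lemma Ck_on_const: "Ck_on k (\<lambda>x. c) S"
  by (induction k arbitrary: c) simp_all

lemma Ck_on_add:
  assumes "open S" "Ck_on k f S" "Ck_on k g S"
  shows "Ck_on k (\<lambda>x. f x + g x) S"
  using assms(2,3)
proof (induction k arbitrary: f g)
  case 0
  then show ?case by (auto intro: continuous_intros)
next
  case (Suc k)
  have d: "((\<lambda>x. f x + g x) has_derivative
      (\<lambda>v. frechet_derivative f (at x) v + frechet_derivative g (at x) v)) (at x)" if "x \<in> S" for x
    using Suc.prems that by (intro has_derivative_add) (auto simp: frechet_derivative_works)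
  have "Ck_on k (\<lambda>x. frechet_derivative (\<lambda>x. f x + g x) (at x) v) S" for v
  proof (rule Ck_on_cong[OF assms(1)])
    show "Ck_on k (\<lambda>x. frechet_derivative f (at x) v + frechet_derivative g (at x) v) S"
      using Suc.prems by (intro Suc.IH) auto
  qed (simp add: fun_cong[OF frechet_derivative_at[OF d]])
  then show ?case using differentiableI[OF d] by simp
qed

lemma Ck_on_sum:
  assumes "open S" "\<And>i. i \<in> A \<Longrightarrow> Ck_on k (f i) S"
  shows "Ck_on k (\<lambda>x. \<Sum>i\<in>A. f i x) S"
  using assms(2)
  by (induction A rule: infinite_finite_induct) (simp_all add: Ck_on_const Ck_on_add[OF assms(1)])

lemma Ck_on_bounded_linear:
  assumes "open S" "bounded_linear L" "Ck_on k f S"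
  shows "Ck_on k (\<lambda>x. L (f x)) S"
  using assms(3)
proof (induction k arbitrary: f)
  case 0
  then show ?case using assms(2) by (auto intro: bounded_linear.continuous_on)
next
  case (Suc k)
  have d: "((\<lambda>x. L (f x)) has_derivative (\<lambda>v. L (frechet_derivative f (at x) v))) (at x)"
    if "x \<in> S" for x
    using Suc.prems that
    by (intro bounded_linear.has_derivative[OF assms(2)]) (auto simp: frechet_derivative_works)
  have "Ck_on k (\<lambda>x. frechet_derivative (\<lambda>x. L (f x)) (at x) v) S" for v
  proof (rule Ck_on_cong[OF assms(1)])
    show "Ck_on k (\<lambda>x. L (frechet_derivative f (at x) v)) S"
      using Suc.prems by (intro Suc.IH) auto
  qed (simp add: fun_cong[OF frechet_derivative_at[OF d]])
  then show ?case using differentiableI[OF d] by simp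
qed

lemma Ck_on_scaleR:
  fixes c :: "'a::real_normed_vector \<Rightarrow> real"
  assumes "open S" "Ck_on k c S" "Ck_on k g S"
  shows "Ck_on k (\<lambda>x. c x *\<^sub>R g x) S"
  using assms(2,3)
proof (induction k arbitrary: c g)
  case 0
  then show ?case by (auto intro: continuous_intros)
next
  case (Suc k)
  have d: "((\<lambda>x. c x *\<^sub>R g x) has_derivative
      (\<lambda>v. c x *\<^sub>R frechet_derivative g (at x) v + frechet_derivative c (at x) v *\<^sub>R g x)) (at x)"
    if "x \<in> S" for x
    using Suc.prems that by (intro has_derivative_scaleR) (auto simp: frechet_derivative_works)
  have "Ck_on k (\<lambda>x. frechet_derivative (\<lambda>x. c x *\<^sub>R g x) (at x) v) S" for v
  proof (rule Ck_on_cong[OF assms(1)])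
    show "Ck_on k (\<lambda>x. c x *\<^sub>R frechet_derivative g (at x) v + frechet_derivative c (at x) v *\<^sub>R g x) S"
      using Suc.prems Suc.prems[THEN Ck_on_SucD] by (intro Ck_on_add[OF assms(1)] Suc.IH) auto
  qed (simp add: fun_cong[OF frechet_derivative_at[OF d]])
  then show ?case using differentiableI[OF d] by simp
qed

text \<open>Bundle maps are required to be smooth on each fixed vector \<open>w\<close> only.
  Expanding \<open>f x\<close> in a basis turns \<open>F x (f x)\<close> into a finite sum of smooth
  coefficients times such families.\<close>

lemma smooth_on_finite_dim_family:
  fixes F :: "'n::real_normed_vector \<Rightarrow> 'f::real_normed_vector \<Rightarrow> 'g::real_normed_vector"
  assumes "finite_dim TYPE('f)" "open S" "smooth_on f S"
    and "\<And>x. x \<in> S \<Longrightarrow> linear (F x)" "\<And>w. smooth_on (\<lambda>x. F x w) S"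
  shows "smooth_on (\<lambda>x. F x (f x)) S"
proof -
  obtain B :: "'f set" and r where B: "finite B" "\<And>b. b \<in> B \<Longrightarrow> bounded_linear (r b)"
    "\<And>x. x = (\<Sum>b\<in>B. r b x *\<^sub>R b)"
    using finite_dim_coordinates[OF assms(1)] by metis
  have F: "F x w = (\<Sum>b\<in>B. r b w *\<^sub>R F x b)" if "x \<in> S" for x w
  proof -
    have "F x w = F x (\<Sum>b\<in>B. r b w *\<^sub>R b)" using B(3)[of w] by (rule arg_cong)
    also have "\<dots> = (\<Sum>b\<in>B. F x (r b w *\<^sub>R b))" by (rule linear_sum[OF assms(4)[OF that]])
    also have "\<dots> = (\<Sum>b\<in>B. r b w *\<^sub>R F x b)"
      by (intro sum.cong refl linear_scale[OF assms(4)[OF that]])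
    finally show ?thesis .
  qed
  have "Ck_on k (\<lambda>x. F x (f x)) S" for k
  proof (rule Ck_on_cong[OF assms(2)])
    show "Ck_on k (\<lambda>x. \<Sum>b\<in>B. r b (f x) *\<^sub>R F x b) S"
    proof (intro Ck_on_sum Ck_on_scaleR assms(2))
      fix b assume "b \<in> B"
      then show "Ck_on k (\<lambda>x. r b (f x)) S"
        using assms(3) by (intro Ck_on_bounded_linear[OF assms(2) B(2)]) (auto simp: smooth_on_def)
      show "Ck_on k (\<lambda>x. F x b) S" using assms(5) by (auto simp: smooth_on_def)
    qed
  qed (rule F[symmetric])
  then show ?thesis by (simp add: smooth_on_def)
qed

section \<open>Smooth maps on a manifold, read in charts\<close>

lemma chart_inverse:
  assumes "smooth_manifold A" "(U, \<phi>) \<in> A" "p \<in> U"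
  shows "inv_into U \<phi> (\<phi> p) = p"
  using assms by (fastforce simp: smooth_manifold_def homeomorphism_def)

lemma open_chart_image:
  assumes "smooth_manifold A" "(U, \<phi>) \<in> A" "open W"
  shows "open (\<phi> ` (U \<inter> W))"
proof -
  have hom: "homeomorphism U (\<phi> ` U) \<phi> (inv_into U \<phi>)" and op: "open (\<phi> ` U)"
    using assms(1,2) unfolding smooth_manifold_def by blast+
  have "openin (top_of_set U) (U \<inter> W)" using assms(3) by (simp add: openin_open_Int)
  then have "openin (top_of_set (\<phi> ` U)) (\<phi> ` (U \<inter> W))"
    by (rule homeomorphism_imp_open_map[OF hom])
  then show ?thesis using op openin_open_trans by blast
qed

lemma smooth_map_onI:
  assumes "\<And>U \<phi> k. (U, \<phi>) \<in> A \<Longrightarrow> Ck_on k (f \<circ> inv_into U \<phi>) (\<phi> ` (U \<inter> W))"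
  shows "smooth_map_on A W f"
  using assms by (auto simp: smooth_map_on_def smooth_on_def)

lemma smooth_map_onD:
  assumes "smooth_map_on A W f" "(U, \<phi>) \<in> A"
  shows "Ck_on k (f \<circ> inv_into U \<phi>) (\<phi> ` (U \<inter> W))"
  using assms by (auto simp: smooth_map_on_def smooth_on_def)

lemma smooth_map_on_subset: "smooth_map_on A W f \<Longrightarrow> W' \<subseteq> W \<Longrightarrow> smooth_map_on A W' f"
  by (intro smooth_map_onI) (metis Ck_on_subset smooth_map_onD image_mono Int_mono order_refl)

lemma smooth_map_on_cong:
  assumes "smooth_manifold A" "open W" "\<And>p. p \<in> W \<Longrightarrow> f p = h p" "smooth_map_on A W f"
  shows "smooth_map_on A W h"
proof (intro smooth_map_onI)
  fix U \<phi> k assume U: "(U, \<phi>) \<in> A"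
  show "Ck_on k (h \<circ> inv_into U \<phi>) (\<phi> ` (U \<inter> W))"
  proof (rule Ck_on_cong[OF open_chart_image[OF assms(1) U assms(2)]])
    show "Ck_on k (f \<circ> inv_into U \<phi>) (\<phi> ` (U \<inter> W))"
      by (rule smooth_map_onD[OF assms(4) U])
  qed (auto simp: chart_inverse[OF assms(1) U] assms(3))
qed

lemma smooth_map_on_local:
  assumes "smooth_manifold A" "\<And>p. p \<in> W \<Longrightarrow> \<exists>W'. open W' \<and> p \<in> W' \<and> smooth_map_on A W' f"
  shows "smooth_map_on A W f"
proof (intro smooth_map_onI Ck_on_local)
  fix U \<phi> k x assume U: "(U, \<phi>) \<in> A" and "x \<in> \<phi> ` (U \<inter> W)"
  then obtain q where q: "q \<in> U" "q \<in> W" "x = \<phi> q" by auto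
  then obtain W' where "open W'" "q \<in> W'" "smooth_map_on A W' f" using assms(2) by blast
  then show "\<exists>T. open T \<and> x \<in> T \<and> Ck_on k (f \<circ> inv_into U \<phi>) T"
    using q open_chart_image[OF assms(1) U] smooth_map_onD[OF _ U]
    by (intro exI[of _ "\<phi> ` (U \<inter> W')"]) auto
qed

lemma smooth_map_on_const: "smooth_map_on A W (\<lambda>p. c)"
  by (intro smooth_map_onI) (simp add: comp_def Ck_on_const)

lemma smooth_map_on_add:
  assumes "smooth_manifold A" "open W" "smooth_map_on A W f" "smooth_map_on A W h"
  shows "smooth_map_on A W (\<lambda>p. f p + h p)"
  using smooth_map_onD[OF assms(3)] smooth_map_onD[OF assms(4)] open_chart_image[OF assms(1) _ assms(2)]
  by (intro smooth_map_onI) (auto simp: comp_def intro: Ck_on_add)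

lemma smooth_map_on_scaleR:
  assumes "smooth_manifold A" "open W" "smooth_map_on A W f"
  shows "smooth_map_on A W (\<lambda>p. c *\<^sub>R f p)"
  using smooth_map_onD[OF assms(3)] open_chart_image[OF assms(1) _ assms(2)]
  by (intro smooth_map_onI)
    (auto simp: comp_def intro: Ck_on_bounded_linear[OF _ bounded_linear_scaleR_right])

lemma smooth_map_on_finite_dim_family:
  fixes F :: "'m::{t2_space, second_countable_topology} \<Rightarrow> 'f::real_normed_vector \<Rightarrow> 'h::real_normed_vector"
  assumes "smooth_manifold A" "finite_dim TYPE('f)" "open W" "smooth_map_on A W f"
    and "\<And>p. p \<in> W \<Longrightarrow> linear (F p)" "\<And>w. smooth_map_on A W (\<lambda>p. F p w)"
  shows "smooth_map_on A W (\<lambda>p. F p (f p))"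
proof (intro smooth_map_onI)
  fix U \<phi> k assume U: "(U, \<phi>) \<in> A"
  have "smooth_on (\<lambda>x. F (inv_into U \<phi> x) ((f \<circ> inv_into U \<phi>) x)) (\<phi> ` (U \<inter> W))"
  proof (rule smooth_on_finite_dim_family[OF assms(2) open_chart_image[OF assms(1) U assms(3)]])
    show "smooth_on (f \<circ> inv_into U \<phi>) (\<phi> ` (U \<inter> W))"
      using smooth_map_onD[OF assms(4) U] by (simp add: smooth_on_def)
    show "smooth_on (\<lambda>x. F (inv_into U \<phi> x) w) (\<phi> ` (U \<inter> W))" for w
      using smooth_map_onD[OF assms(6) U] by (simp add: smooth_on_def comp_def)
    show "linear (F (inv_into U \<phi> x))" if "x \<in> \<phi> ` (U \<inter> W)" for x
      using that assms(5) chart_inverse[OF assms(1) U] by auto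
  qed
  then show "Ck_on k ((\<lambda>p. F p (f p)) \<circ> inv_into U \<phi>) (\<phi> ` (U \<inter> W))"
    by (simp add: smooth_on_def comp_def)
qed


section \<open>Sections and bundle maps in coordinates\<close>

locale smooth_vector_bundle =
  fixes A :: "('m::{t2_space, second_countable_topology}, 'n::real_normed_vector) atlas"
    and E :: "('m, 'e, 'f::real_normed_vector) vbundle"
  assumes manifold: "smooth_manifold A" and vec_bundle: "vector_bundle A E"
begin

section \<open>Local trivializations and fibre operations\<close>

lemma finite_dim_fibre: "finite_dim TYPE('f)"
  using vec_bundle by (simp add: vector_bundle_def)

lemma triv_exists: "\<exists>U \<psi>. (U, \<psi>) \<in> trivs E \<and> p \<in> U"
proof -
  have "p \<in> (\<Union>(U, \<psi>)\<in>trivs E. U)" using vec_bundle by (simp add: vector_bundle_def)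
  then show ?thesis by auto
qed

lemma triv_open: "(U, \<psi>) \<in> trivs E \<Longrightarrow> open U"
  using vec_bundle by (auto simp: vector_bundle_def)

lemma triv_fibre:
  assumes "(U, \<psi>) \<in> trivs E" "p \<in> U"
  shows "bij_betw \<psi> (fibre E p) UNIV"
    and "fzero E p \<in> fibre E p" "\<psi> (fzero E p) = 0"
    and "u \<in> fibre E p \<Longrightarrow> v \<in> fibre E p \<Longrightarrow> fadd E u v \<in> fibre E p"
    and "u \<in> fibre E p \<Longrightarrow> v \<in> fibre E p \<Longrightarrow> \<psi> (fadd E u v) = \<psi> u + \<psi> v"
    and "u \<in> fibre E p \<Longrightarrow> fscale E c u \<in> fibre E p"
    and "u \<in> fibre E p \<Longrightarrow> \<psi> (fscale E c u) = c *\<^sub>R \<psi> u"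
proof -
  have "\<forall>(U, \<psi>)\<in>trivs E. open U \<and>
        (\<forall>p\<in>U. bij_betw \<psi> (fibre E p) UNIV \<and>
           fzero E p \<in> fibre E p \<and> \<psi> (fzero E p) = 0 \<and>
           (\<forall>u\<in>fibre E p. \<forall>v\<in>fibre E p.
              fadd E u v \<in> fibre E p \<and> \<psi> (fadd E u v) = \<psi> u + \<psi> v) \<and>
           (\<forall>c. \<forall>u\<in>fibre E p.
              fscale E c u \<in> fibre E p \<and> \<psi> (fscale E c u) = c *\<^sub>R \<psi> u))"
    using vec_bundle unfolding vector_bundle_def by blast
  from bspec[OF this assms(1)] assms(2)
  have *: "bij_betw \<psi> (fibre E p) UNIV \<and>
           fzero E p \<in> fibre E p \<and> \<psi> (fzero E p) = 0 \<and>
           (\<forall>u\<in>fibre E p. \<forall>v\<in>fibre E p.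
              fadd E u v \<in> fibre E p \<and> \<psi> (fadd E u v) = \<psi> u + \<psi> v) \<and>
           (\<forall>c. \<forall>u\<in>fibre E p.
              fscale E c u \<in> fibre E p \<and> \<psi> (fscale E c u) = c *\<^sub>R \<psi> u)"
    by blast
  show "bij_betw \<psi> (fibre E p) UNIV" "fzero E p \<in> fibre E p" "\<psi> (fzero E p) = 0"
    "u \<in> fibre E p \<Longrightarrow> v \<in> fibre E p \<Longrightarrow> fadd E u v \<in> fibre E p"
    "u \<in> fibre E p \<Longrightarrow> v \<in> fibre E p \<Longrightarrow> \<psi> (fadd E u v) = \<psi> u + \<psi> v"
    "u \<in> fibre E p \<Longrightarrow> fscale E c u \<in> fibre E p"
    "u \<in> fibre E p \<Longrightarrow> \<psi> (fscale E c u) = c *\<^sub>R \<psi> u"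
    using * by simp_all
qed

lemma triv_inv:
  assumes "(U, \<psi>) \<in> trivs E" "p \<in> U"
  shows "triv_inv E \<psi> p w \<in> fibre E p" "\<psi> (triv_inv E \<psi> p w) = w"
    and "u \<in> fibre E p \<Longrightarrow> triv_inv E \<psi> p (\<psi> u) = u"
proof -
  have bij: "bij_betw \<psi> (fibre E p) UNIV" using triv_fibre(1)[OF assms] .
  show "triv_inv E \<psi> p w \<in> fibre E p" "\<psi> (triv_inv E \<psi> p w) = w"
    using bij inv_into_into[of w \<psi> "fibre E p"] f_inv_into_f[of w \<psi> "fibre E p"]
    by (simp_all add: bij_betw_def)
  show "triv_inv E \<psi> p (\<psi> u) = u" if "u \<in> fibre E p"
    using bij that by (simp add: bij_betw_def)
qed

lemma triv_inv_linear:
  assumes "(U, \<psi>) \<in> trivs E" "p \<in> U"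
  shows "triv_inv E \<psi> p (v + w) = fadd E (triv_inv E \<psi> p v) (triv_inv E \<psi> p w)"
    and "triv_inv E \<psi> p (c *\<^sub>R w) = fscale E c (triv_inv E \<psi> p w)"
proof -
  let ?v = "triv_inv E \<psi> p v" and ?w = "triv_inv E \<psi> p w"
  have "v + w = \<psi> (fadd E ?v ?w)" "c *\<^sub>R w = \<psi> (fscale E c ?w)"
    using triv_fibre(5,7)[OF assms] triv_inv[OF assms] by simp_all
  then show "triv_inv E \<psi> p (v + w) = fadd E ?v ?w" "triv_inv E \<psi> p (c *\<^sub>R w) = fscale E c ?w"
    using triv_inv(3)[OF assms] triv_fibre(4,6)[OF assms] triv_inv(1)[OF assms] by simp_all
qed

lemma fibre_closed:
  "fzero E p \<in> fibre E p"
  "u \<in> fibre E p \<Longrightarrow> v \<in> fibre E p \<Longrightarrow> fadd E u v \<in> fibre E p"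
  "u \<in> fibre E p \<Longrightarrow> fscale E c u \<in> fibre E p"
proof -
  obtain U \<psi> where "(U, \<psi>) \<in> trivs E" "p \<in> U" using triv_exists by blast
  note * = triv_fibre[OF this]
  show "fzero E p \<in> fibre E p"
    "u \<in> fibre E p \<Longrightarrow> v \<in> fibre E p \<Longrightarrow> fadd E u v \<in> fibre E p"
    "u \<in> fibre E p \<Longrightarrow> fscale E c u \<in> fibre E p"
    by (fact *)+
qed

lemma bundle_mapD:
  assumes "bundle_map A E E F"
  shows "u \<in> fibre E p \<Longrightarrow> F u \<in> fibre E p"
    and "u \<in> fibre E p \<Longrightarrow> v \<in> fibre E p \<Longrightarrow> F (fadd E u v) = fadd E (F u) (F v)"
    and "u \<in> fibre E p \<Longrightarrow> F (fscale E c u) = fscale E c (F u)"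
    and "(U, \<psi>) \<in> trivs E \<Longrightarrow> (U', \<psi>') \<in> trivs E \<Longrightarrow>
      smooth_map_on A (U \<inter> U') (\<lambda>p. \<psi>' (F (triv_inv E \<psi> p w)))"
  using assms unfolding bundle_map_def by blast+

lemma bundle_map_local_linear:
  assumes "bundle_map A E E F" "(U, \<psi>) \<in> trivs E" "(U', \<psi>') \<in> trivs E" "p \<in> U" "p \<in> U'"
  shows "linear (\<lambda>w. \<psi>' (F (triv_inv E \<psi> p w)))"
  by (intro linearI)
    (simp_all add: triv_inv_linear[OF assms(2,4)] triv_inv[OF assms(2,4)]
      bundle_mapD(1-3)[OF assms(1), of _ p] triv_fibre[OF assms(3,5)])

text \<open>\<open>X\<close> is defined over an open \<open>W\<close> rather than globally, so that
  the result also covers the local sections \<open>G (triv_inv E \<psi> p w)\<close> in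
  \<open>bundle_map_comp\<close>. Near each point a trivialization is inserted between
  \<open>X\<close> and \<open>F\<close>, and the linear local form of \<open>F\<close> acts on
  smooth coordinates.\<close>

lemma smooth_bundle_map_comp:
  assumes F: "bundle_map A E E F" and W: "open W"
    and X: "\<And>p. p \<in> W \<Longrightarrow> X p \<in> fibre E p"
    and smooth: "\<And>U \<psi>. (U, \<psi>) \<in> trivs E \<Longrightarrow> smooth_map_on A (W \<inter> U) (\<lambda>p. \<psi> (X p))"
    and triv: "(U', \<psi>') \<in> trivs E"
  shows "smooth_map_on A (W \<inter> U') (\<lambda>p. \<psi>' (F (X p)))"
proof (rule smooth_map_on_local[OF manifold])
  fix p assume p: "p \<in> W \<inter> U'"
  obtain U \<psi> where U: "(U, \<psi>) \<in> trivs E" "p \<in> U" using triv_exists by blast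
  let ?V = "W \<inter> U' \<inter> U"
  have op: "open ?V" using W triv_open[OF U(1)] triv_open[OF triv] by auto
  have "smooth_map_on A ?V (\<lambda>p. \<psi>' (F (triv_inv E \<psi> p (\<psi> (X p)))))"
  proof (rule smooth_map_on_finite_dim_family[OF manifold finite_dim_fibre op,
        where F = "\<lambda>p w. \<psi>' (F (triv_inv E \<psi> p w))" and f = "\<lambda>p. \<psi> (X p)"])
    show "smooth_map_on A ?V (\<lambda>p. \<psi> (X p))"
      by (rule smooth_map_on_subset[OF smooth[OF U(1)]]) auto
    show "smooth_map_on A ?V (\<lambda>p. \<psi>' (F (triv_inv E \<psi> p w)))" for w
      by (rule smooth_map_on_subset[OF bundle_mapD(4)[OF F U(1) triv]]) auto
    show "linear (\<lambda>w. \<psi>' (F (triv_inv E \<psi> p w)))" if "p \<in> ?V" for p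
      using that by (intro bundle_map_local_linear[OF F U(1) triv]) auto
  qed
  then have "smooth_map_on A ?V (\<lambda>p. \<psi>' (F (X p)))"
    by (rule smooth_map_on_cong[OF manifold op, rotated]) (simp add: triv_inv(3)[OF U(1)] X)
  then show "\<exists>W'. open W' \<and> p \<in> W' \<and> smooth_map_on A W' (\<lambda>p. \<psi>' (F (X p)))"
    using op p U(2) by blast
qed

section \<open>Closure properties of smooth sections and bundle endomorphisms\<close>

lemma sectionsD:
  assumes "X \<in> sections A E"
  shows "X p \<in> fibre E p" "(U, \<psi>) \<in> trivs E \<Longrightarrow> smooth_map_on A U (\<lambda>p. \<psi> (X p))"
  using assms by (auto simp: sections_def)

lemma sectionsI:
  assumes "\<And>p. X p \<in> fibre E p" "\<And>U \<psi>. (U, \<psi>) \<in> trivs E \<Longrightarrow> smooth_map_on A U (\<lambda>p. \<psi> (X p))"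
  shows "X \<in> sections A E"
  using assms by (auto simp: sections_def)

lemma bundle_map_section:
  assumes "bundle_map A E E F" "X \<in> sections A E"
  shows "F \<circ> X \<in> sections A E"
proof (rule sectionsI)
  show "(F \<circ> X) p \<in> fibre E p" for p
    using bundle_mapD(1)[OF assms(1)] sectionsD(1)[OF assms(2)] by simp
  show "smooth_map_on A U (\<lambda>p. \<psi> ((F \<circ> X) p))" if "(U, \<psi>) \<in> trivs E" for U \<psi>
    using smooth_bundle_map_comp[OF assms(1) open_UNIV, of X U \<psi>] sectionsD[OF assms(2)] that
    by simp
qed

lemma section_add:
  assumes "X \<in> sections A E" "Y \<in> sections A E"
  shows "sec_add E X Y \<in> sections A E"
proof (rule sectionsI)
  show "sec_add E X Y p \<in> fibre E p" for p
    using assms by (simp add: sec_add_def fibre_closed sectionsD)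
  show "smooth_map_on A U (\<lambda>p. \<psi> (sec_add E X Y p))" if U: "(U, \<psi>) \<in> trivs E" for U \<psi>
    by (rule smooth_map_on_cong[OF manifold triv_open[OF U] _ smooth_map_on_add[OF manifold
          triv_open[OF U] sectionsD(2)[OF assms(1) U] sectionsD(2)[OF assms(2) U]]])
      (simp add: sec_add_def triv_fibre[OF U] sectionsD(1) assms)
qed

lemma section_scale:
  assumes "X \<in> sections A E"
  shows "sec_scale E c X \<in> sections A E"
proof (rule sectionsI)
  show "sec_scale E c X p \<in> fibre E p" for p
    using assms by (simp add: sec_scale_def fibre_closed sectionsD)
  show "smooth_map_on A U (\<lambda>p. \<psi> (sec_scale E c X p))" if U: "(U, \<psi>) \<in> trivs E" for U \<psi>
    by (rule smooth_map_on_cong[OF manifold triv_open[OF U] _ smooth_map_on_scaleR[OF manifold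
          triv_open[OF U] sectionsD(2)[OF assms U], where c = c]])
      (simp add: sec_scale_def triv_fibre[OF U] sectionsD(1) assms)
qed

lemma section_diff:
  "X \<in> sections A E \<Longrightarrow> Y \<in> sections A E \<Longrightarrow> sec_diff E X Y \<in> sections A E"
  by (simp add: sec_diff_def section_add section_scale)

lemma section_zero: "fzero E \<in> sections A E"
proof (rule sectionsI)
  show "fzero E p \<in> fibre E p" for p by (rule fibre_closed)
  show "smooth_map_on A U (\<lambda>p. \<psi> (fzero E p))" if U: "(U, \<psi>) \<in> trivs E" for U \<psi>
    by (rule smooth_map_on_cong[OF manifold triv_open[OF U] _ smooth_map_on_const[where c = 0]])
      (simp add: triv_fibre[OF U])
qed

lemma bundle_map_comp:
  assumes "bundle_map A E E F" "bundle_map A E E G"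
  shows "bundle_map A E E (F \<circ> G)"
proof -
  have "smooth_map_on A (U \<inter> U') (\<lambda>p. \<psi>' (F (G (triv_inv E \<psi> p w))))"
    if "(U, \<psi>) \<in> trivs E" "(U', \<psi>') \<in> trivs E" for U \<psi> U' \<psi>' w
    using that triv_inv(1) bundle_mapD[OF assms(2)]
    by (intro smooth_bundle_map_comp[OF assms(1) triv_open]) auto
  moreover have "F (G (fadd E u v)) = fadd E (F (G u)) (F (G v))"
    if "u \<in> fibre E p" "v \<in> fibre E p" for u v p
    using that bundle_mapD(1,2)[OF assms(1), of _ p] bundle_mapD(1,2)[OF assms(2), of _ p] by simp
  moreover have "F (G (fscale E c u)) = fscale E c (F (G u))" if "u \<in> fibre E p" for c u p
    using that bundle_mapD(3)[OF assms(1), of _ p] bundle_mapD(1,3)[OF assms(2), of _ p] by simp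
  ultimately show ?thesis
    using bundle_mapD(1)[OF assms(1)] bundle_mapD(1)[OF assms(2)]
    unfolding bundle_map_def comp_apply by blast
qed

lemma bundle_map_id: "bundle_map A E E id"
  using vec_bundle by (auto simp: bundle_map_def vector_bundle_def)

lemma bundle_map_funpow: "bundle_map A E E F \<Longrightarrow> bundle_map A E E (F ^^ n)"
  by (induction n) (auto intro: bundle_map_id bundle_map_comp)

text \<open>The total space is a plain type whose operations are record fields. One trivialization
  chosen at each point identifies the fibre with the group \<open>'f\<close>. The choice need not be
  continuous in \<open>p\<close>: smoothness is remembered through the set
  \<open>coord_sections\<close>.\<close>

definition coord :: "'m \<Rightarrow> 'e \<Rightarrow> 'f" where
  "coord p = snd (SOME t. t \<in> trivs E \<and> p \<in> fst t)"

lemma coord_triv: "\<exists>U. (U, coord p) \<in> trivs E \<and> p \<in> U"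
proof -
  define t where "t = (SOME t. t \<in> trivs E \<and> p \<in> fst t)"
  have "\<exists>t. t \<in> trivs E \<and> p \<in> fst t" using triv_exists[of p] by auto
  then have "t \<in> trivs E \<and> p \<in> fst t" unfolding t_def by (rule someI_ex)
  then show ?thesis by (intro exI[of _ "fst t"]) (simp add: coord_def t_def[symmetric])
qed

lemma coord_simps:
  "u \<in> fibre E p \<Longrightarrow> v \<in> fibre E p \<Longrightarrow> coord p (fadd E u v) = coord p u + coord p v"
  "u \<in> fibre E p \<Longrightarrow> coord p (fscale E c u) = c *\<^sub>R coord p u"
  "coord p (fzero E p) = 0"
  "triv_inv E (coord p) p w \<in> fibre E p"
  "coord p (triv_inv E (coord p) p w) = w"
  "u \<in> fibre E p \<Longrightarrow> triv_inv E (coord p) p (coord p u) = u"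
  "triv_inv E (coord p) p (w + w') = fadd E (triv_inv E (coord p) p w) (triv_inv E (coord p) p w')"
proof -
  obtain U where U: "(U, coord p) \<in> trivs E" "p \<in> U" using coord_triv by blast
  note * = triv_fibre[OF U] triv_inv[OF U] triv_inv_linear[OF U]
  show "u \<in> fibre E p \<Longrightarrow> v \<in> fibre E p \<Longrightarrow> coord p (fadd E u v) = coord p u + coord p v"
    "u \<in> fibre E p \<Longrightarrow> coord p (fscale E c u) = c *\<^sub>R coord p u"
    "coord p (fzero E p) = 0"
    "triv_inv E (coord p) p w \<in> fibre E p"
    "coord p (triv_inv E (coord p) p w) = w"
    "u \<in> fibre E p \<Longrightarrow> triv_inv E (coord p) p (coord p u) = u"
    "triv_inv E (coord p) p (w + w') = fadd E (triv_inv E (coord p) p w) (triv_inv E (coord p) p w')"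
    by (fact *)+
qed

lemma coord_inject:
  "u \<in> fibre E p \<Longrightarrow> v \<in> fibre E p \<Longrightarrow> coord p u = coord p v \<longleftrightarrow> u = v"
  using coord_simps(6)[of u p] coord_simps(6)[of v p] by metis

lemma bundle_map_add:
  assumes "bundle_map A E E F" "bundle_map A E E G"
  shows "bundle_map A E E (tensor_add E F G)"
proof -
  have "smooth_map_on A (U \<inter> U') (\<lambda>p. \<psi>' (fadd E (F (triv_inv E \<psi> p w)) (G (triv_inv E \<psi> p w))))"
    if U: "(U, \<psi>) \<in> trivs E" and U': "(U', \<psi>') \<in> trivs E" for U \<psi> U' \<psi>' w
  proof (rule smooth_map_on_cong[OF manifold])
    show "open (U \<inter> U')" using triv_open U U' by auto
    then show "smooth_map_on A (U \<inter> U') (\<lambda>p. \<psi>' (F (triv_inv E \<psi> p w)) + \<psi>' (G (triv_inv E \<psi> p w)))"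
      using bundle_mapD(4)[OF assms(1) U U'] bundle_mapD(4)[OF assms(2) U U']
      by (intro smooth_map_on_add[OF manifold])
    show "\<psi>' (F (triv_inv E \<psi> p w)) + \<psi>' (G (triv_inv E \<psi> p w))
      = \<psi>' (fadd E (F (triv_inv E \<psi> p w)) (G (triv_inv E \<psi> p w)))" if "p \<in> U \<inter> U'" for p
      using that by (simp add: triv_fibre(5)[OF U', of p] triv_inv(1)[OF U, of p]
          bundle_mapD(1)[OF assms(1), of _ p] bundle_mapD(1)[OF assms(2), of _ p])
  qed
  moreover have "fadd E (F (fadd E u v)) (G (fadd E u v)) = fadd E (fadd E (F u) (G u)) (fadd E (F v) (G v))"
    (is "?l = ?r")
    and "fadd E (F (fscale E c u)) (G (fscale E c u)) = fscale E c (fadd E (F u) (G u))"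
    (is "?l' = ?r'")
    if uv: "u \<in> fibre E p" "v \<in> fibre E p" for u v c p
  proof -
    note mem = uv bundle_mapD(1)[OF assms(1) uv(1)] bundle_mapD(1)[OF assms(1) uv(2)]
      bundle_mapD(1)[OF assms(2) uv(1)] bundle_mapD(1)[OF assms(2) uv(2)]
    note lin = bundle_mapD(2)[OF assms(1) uv] bundle_mapD(3)[OF assms(1) uv(1), of c]
      bundle_mapD(2)[OF assms(2) uv] bundle_mapD(3)[OF assms(2) uv(1), of c]
    have "coord p ?l = coord p ?r" "coord p ?l' = coord p ?r'"
      unfolding lin by (simp_all add: coord_simps(1,2) fibre_closed mem scaleR_add_right)
    then show "?l = ?r" "?l' = ?r'"
      unfolding lin by (simp_all add: coord_inject fibre_closed mem)
  qed
  moreover have "fadd E (F u) (G u) \<in> fibre E p" if "u \<in> fibre E p" for u p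
    using that by (intro fibre_closed bundle_mapD(1)[OF assms(1)] bundle_mapD(1)[OF assms(2)])
  ultimately show ?thesis
    unfolding bundle_map_def tensor_add_def by blast
qed

definition coords :: "('m \<Rightarrow> 'e) \<Rightarrow> 'm \<Rightarrow> 'f" where
  "coords X = (\<lambda>p. coord p (X p))"

definition of_coords :: "('m \<Rightarrow> 'f) \<Rightarrow> 'm \<Rightarrow> 'e" where
  "of_coords x = (\<lambda>p. triv_inv E (coord p) p (x p))"

definition hat :: "('e \<Rightarrow> 'e) \<Rightarrow> ('m \<Rightarrow> 'f) \<Rightarrow> 'm \<Rightarrow> 'f" where
  "hat F x = coords (F \<circ> of_coords x)"

definition coord_sections :: "('m \<Rightarrow> 'f) set" where
  "coord_sections = coords ` sections A E"

definition coord_bracket :: "('m, 'e) cstruct \<Rightarrow> ('m \<Rightarrow> 'f) \<Rightarrow> ('m \<Rightarrow> 'f) \<Rightarrow> 'm \<Rightarrow> 'f" where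
  "coord_bracket \<Theta> = (\<lambda>x y. if x \<in> coord_sections \<and> y \<in> coord_sections
     then coords (snd \<Theta> (of_coords x) (of_coords y)) else 0)"

section \<open>Passage between sections and coordinate functions\<close>

lemma of_coords_fibre: "of_coords x p \<in> fibre E p"
  by (simp add: of_coords_def coord_simps)

lemma coords_of_coords: "coords (of_coords x) = x"
  by (simp add: coords_def of_coords_def coord_simps)

lemma of_coords_coords: "(\<And>p. X p \<in> fibre E p) \<Longrightarrow> of_coords (coords X) = X"
  by (simp add: coords_def of_coords_def coord_simps)

lemma of_coords_section: "x \<in> coord_sections \<Longrightarrow> of_coords x \<in> sections A E"
  by (auto simp: coord_sections_def of_coords_coords sectionsD)

lemma coords_section: "X \<in> sections A E \<Longrightarrow> coords X \<in> coord_sections"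
  by (simp add: coord_sections_def)

lemma coords_simps:
  "X \<in> sections A E \<Longrightarrow> Y \<in> sections A E \<Longrightarrow> coords (sec_add E X Y) = coords X + coords Y"
  "X \<in> sections A E \<Longrightarrow> coords (sec_scale E (- 1) X) = - coords X"
  "X \<in> sections A E \<Longrightarrow> Y \<in> sections A E \<Longrightarrow> coords (sec_diff E X Y) = coords X - coords Y"
  "coords (fzero E) = 0"
  by (auto simp: coords_def sec_diff_def sec_add_def sec_scale_def fun_eq_iff coord_simps sectionsD fibre_closed)

lemma of_coords_add: "of_coords (x + y) = sec_add E (of_coords x) (of_coords y)"
  by (simp add: of_coords_def sec_add_def coord_simps)

lemma of_coords_hat: "bundle_map A E E F \<Longrightarrow> of_coords (hat F x) = F \<circ> of_coords x"
  unfolding hat_def by (rule of_coords_coords) (auto intro: bundle_mapD of_coords_fibre)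

lemma hat_comp: "bundle_map A E E G \<Longrightarrow> hat (F \<circ> G) = hat F \<circ> hat G"
  by (simp add: fun_eq_iff hat_def[of F] of_coords_hat) (simp add: hat_def comp_assoc)

lemma hat_id: "hat id = id"
  by (simp add: fun_eq_iff hat_def coords_of_coords)

lemma hat_funpow: "bundle_map A E E F \<Longrightarrow> hat (F ^^ n) = hat F ^^ n"
  by (induction n) (simp_all add: hat_id hat_comp bundle_map_funpow)

lemma hat_add:
  assumes "bundle_map A E E F" "bundle_map A E E G"
  shows "hat (tensor_add E F G) = hat F + hat G"
  using bundle_mapD(1)[OF assms(1) of_coords_fibre] bundle_mapD(1)[OF assms(2) of_coords_fibre]
  by (simp add: fun_eq_iff hat_def coords_def tensor_add_def coord_simps)

lemma hat_coords: "X \<in> sections A E \<Longrightarrow> hat F (coords X) = coords (F \<circ> X)"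
  by (simp add: hat_def of_coords_coords sectionsD)

lemma coord_sections_carrier: "additive_carrier coord_sections"
proof
  show "0 \<in> coord_sections"
    using coords_section[OF section_zero] by (simp add: coords_simps)
  fix x y assume x: "x \<in> coord_sections" and y: "y \<in> coord_sections"
  show "x + y \<in> coord_sections"
    using x y by (auto simp: coord_sections_def coords_simps[symmetric] section_add)
next
  fix x assume x: "x \<in> coord_sections"
  then show "- x \<in> coord_sections"
    by (auto simp: coord_sections_def coords_simps[symmetric] section_scale)
qed

sublocale C: additive_carrier coord_sections
  by (rule coord_sections_carrier)

text \<open>\<open>F\<close> acts fibrewise, so additivity holds for arbitrary functions; smoothness
  of \<open>F\<close> is used for the closure of \<open>coord_sections\<close>.\<close>

lemma endo_hat:
  assumes "bundle_map A E E F"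
  shows "C.endo (hat F)"
  unfolding C.endo_def
proof (intro conjI allI ballI)
  fix x y
  show "hat F (x + y) = hat F x + hat F y"
    using bundle_mapD(1,2)[OF assms of_coords_fibre] of_coords_fibre
    by (simp add: fun_eq_iff hat_def coords_def of_coords_add sec_add_def coord_simps)
next
  fix x assume "x \<in> coord_sections"
  then show "hat F x \<in> coord_sections"
    unfolding hat_def by (intro coords_section bundle_map_section[OF assms] of_coords_section)
qed

text \<open>These properties are preserved by \<open>deform\<close> and suffice for the algebraic
  part. Iterated deformations are handled with this predicate in place of
  \<open>pre_courant_structure\<close>.\<close>

definition bracket_structure :: "('m, 'e) cstruct \<Rightarrow> bool" where
  "bracket_structure \<Theta> \<longleftrightarrow>
     (\<forall>X\<in>sections A E. \<forall>Y\<in>sections A E. snd \<Theta> X Y \<in> sections A E) \<and>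
     coord_bracket \<Theta> \<in> C.brackets"

section \<open>The notions of the theorem in coordinates\<close>

lemma coord_bracket_coords:
  "X \<in> sections A E \<Longrightarrow> Y \<in> sections A E \<Longrightarrow>
     coord_bracket \<Theta> (coords X) (coords Y) = coords (snd \<Theta> X Y)"
  by (simp add: coord_bracket_def coords_section of_coords_coords sectionsD)

lemma deform_section:
  assumes "bundle_map A E E F" "bracket_structure \<Theta>" "X \<in> sections A E" "Y \<in> sections A E"
  shows "snd (deform E \<Theta> F) X Y \<in> sections A E"
  using assms by (cases \<Theta>)
    (auto simp: deform_def bracket_structure_def intro!: section_diff section_add bundle_map_section)

text \<open>This is the bridge to the algebra: \<open>coord\<close> is linear on each fibre and
  hence carries the formula of \<open>deform\<close> to that of \<open>D\<close>.\<close>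

lemma coord_bracket_deform:
  assumes F: "bundle_map A E E F" and \<Theta>: "bracket_structure \<Theta>"
  shows "coord_bracket (deform E \<Theta> F) = C.D (hat F) (coord_bracket \<Theta>)"
proof (intro ext)
  fix x y
  show "coord_bracket (deform E \<Theta> F) x y p = C.D (hat F) (coord_bracket \<Theta>) x y p" for p
  proof (cases "x \<in> coord_sections \<and> y \<in> coord_sections")
    case True
    then obtain X Y where X: "X \<in> sections A E" "x = coords X" and Y: "Y \<in> sections A E" "y = coords Y"
      by (auto simp: coord_sections_def)
    obtain \<rho> br where [simp]: "\<Theta> = (\<rho>, br)" by (cases \<Theta>)
    have br: "br X Y \<in> sections A E" if "X \<in> sections A E" "Y \<in> sections A E" for X Y
      using that \<Theta> by (simp add: bracket_structure_def)
    show ?thesis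
      using X Y
      by (simp add: C.D_def coords_section coord_bracket_coords hat_coords bundle_map_section[OF F])
        (simp add: deform_def coords_simps hat_coords br bundle_map_section[OF F] section_add)
  qed (auto simp: coord_bracket_def C.D_def)
qed

lemma bracket_structure_deform:
  assumes "bundle_map A E E F" "bracket_structure \<Theta>"
  shows "bracket_structure (deform E \<Theta> F)"
  using assms deform_section[OF assms] endo_hat[OF assms(1)]
  by (auto simp: bracket_structure_def[of "deform E \<Theta> F"] coord_bracket_deform)
    (simp add: bracket_structure_def)

lemma bracket_structure_pre_courant:
  assumes "pre_courant_structure A E g \<Theta>"
  shows "bracket_structure \<Theta>"
proof -
  obtain \<rho> br where [simp]: "\<Theta> = (\<rho>, br)" by (cases \<Theta>)
  have closed: "br X Y \<in> sections A E" if "X \<in> sections A E" "Y \<in> sections A E" for X Y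
    using assms that by (simp add: pre_courant_structure_def)
  have add: "br (sec_add E X Y) Z = sec_add E (br X Z) (br Y Z)"
    "br Z (sec_add E X Y) = sec_add E (br Z X) (br Z Y)"
    if "X \<in> sections A E" "Y \<in> sections A E" "Z \<in> sections A E" for X Y Z
    using assms that by (simp_all add: pre_courant_structure_def)
  have "coord_bracket \<Theta> \<in> C.brackets"
    by (intro C.bracketsI)
      (auto simp: coord_bracket_def of_coords_add add closed of_coords_section coords_simps
        C.add_closed)
  then show ?thesis using closed by (simp add: bracket_structure_def)
qed

lemma coords_eq_zero: "X \<in> sections A E \<Longrightarrow> coords X = 0 \<longleftrightarrow> X = fzero E"
  by (metis coords_simps(4) of_coords_coords fibre_closed(1) sectionsD(1))

lemma coord_bracket_eq_zero:
  assumes "\<And>X Y. X \<in> sections A E \<Longrightarrow> Y \<in> sections A E \<Longrightarrow> snd \<Theta> X Y \<in> sections A E"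
  shows "coord_bracket \<Theta> = 0 \<longleftrightarrow> (\<forall>X\<in>sections A E. \<forall>Y\<in>sections A E. snd \<Theta> X Y = fzero E)"
proof
  assume 0: "coord_bracket \<Theta> = 0"
  show "\<forall>X\<in>sections A E. \<forall>Y\<in>sections A E. snd \<Theta> X Y = fzero E"
  proof (intro ballI)
    fix X Y assume "X \<in> sections A E" "Y \<in> sections A E"
    then show "snd \<Theta> X Y = fzero E"
      using coord_bracket_coords[of X Y \<Theta>] coords_eq_zero[OF assms] by (simp add: 0)
  qed
next
  assume "\<forall>X\<in>sections A E. \<forall>Y\<in>sections A E. snd \<Theta> X Y = fzero E"
  then show "coord_bracket \<Theta> = 0"
    by (intro ext) (simp add: coord_bracket_def of_coords_section coords_simps)
qed

lemma bundle_map_fscale: "bundle_map A E E (fscale E c)"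
proof -
  have "smooth_map_on A (U \<inter> U') (\<lambda>p. \<psi>' (fscale E c (triv_inv E \<psi> p w)))"
    if U: "(U, \<psi>) \<in> trivs E" and U': "(U', \<psi>') \<in> trivs E" for U \<psi> U' \<psi>' w
  proof (rule smooth_map_on_cong[OF manifold])
    show "open (U \<inter> U')" using triv_open U U' by auto
    then show "smooth_map_on A (U \<inter> U') (\<lambda>p. c *\<^sub>R \<psi>' (triv_inv E \<psi> p w))"
      using bundle_mapD(4)[OF bundle_map_id U U'] by (intro smooth_map_on_scaleR[OF manifold]) simp_all
    show "c *\<^sub>R \<psi>' (triv_inv E \<psi> p w) = \<psi>' (fscale E c (triv_inv E \<psi> p w))" if "p \<in> U \<inter> U'" for p
      using that by (simp add: triv_fibre(7)[OF U', of p] triv_inv(1)[OF U, of p])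
  qed
  moreover have "fscale E c (fadd E u v) = fadd E (fscale E c u) (fscale E c v)"
    and "fscale E c (fscale E b u) = fscale E b (fscale E c u)"
    if "u \<in> fibre E p" "v \<in> fibre E p" for u v b p
    by (rule coord_inject[THEN iffD1, of _ p];
        simp add: that fibre_closed coord_simps(1,2) scaleR_add_right)+
  ultimately show ?thesis
    using fibre_closed(3) unfolding bundle_map_def by blast
qed

lemma bundle_map_tensor_scale:
  assumes "bundle_map A E E F"
  shows "bundle_map A E E (tensor_scale E c F)"
  using bundle_map_comp[OF bundle_map_fscale assms, of c] by (simp add: tensor_scale_def comp_def)

lemma bundle_map_tensor_bracket:
  assumes "bundle_map A E E F" "bundle_map A E E G"
  shows "bundle_map A E E (tensor_bracket E F G)"
  using assms unfolding tensor_bracket_def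
  by (intro bundle_map_add bundle_map_comp bundle_map_tensor_scale)

lemma hat_uminus:
  assumes "bundle_map A E E F"
  shows "hat (tensor_scale E (- 1) F) x = - hat F x"
  using bundle_mapD(1)[OF assms of_coords_fibre]
  by (simp add: fun_eq_iff hat_def coords_def tensor_scale_def coord_simps)

lemma hat_tensor_bracket:
  assumes "bundle_map A E E F" "bundle_map A E E G"
  shows "hat (tensor_bracket E F G) x = hat G (hat F x) - hat F (hat G x)"
  unfolding tensor_bracket_def
  by (simp add: hat_add hat_uminus hat_comp assms bundle_map_comp bundle_map_tensor_scale)

lemma struct_is_zero_iff:
  assumes "\<And>X Y. X \<in> sections A E \<Longrightarrow> Y \<in> sections A E \<Longrightarrow> snd \<Theta> X Y \<in> sections A E"
  shows "struct_is_zero A E \<Theta> \<longleftrightarrow>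
    (\<forall>p. \<forall>e\<in>fibre E p. fst \<Theta> e = (p, \<lambda>f. 0)) \<and> coord_bracket \<Theta> = 0"
proof -
  have "coord_bracket \<Theta> = 0 \<longleftrightarrow> (\<forall>X\<in>sections A E. \<forall>Y\<in>sections A E. snd \<Theta> X Y = fzero E)"
    by (rule coord_bracket_eq_zero) (rule assms)
  then show ?thesis
    unfolding struct_is_zero_def by (auto simp: fibre_def tangent_bundle_def)
qed

lemma bracket_structure_closed:
  "bracket_structure \<Theta> \<Longrightarrow> X \<in> sections A E \<Longrightarrow> Y \<in> sections A E \<Longrightarrow> snd \<Theta> X Y \<in> sections A E"
  by (simp add: bracket_structure_def)

lemma fst_deform: "fst (deform E \<Theta> F) = fst \<Theta> \<circ> F"
  by (cases \<Theta>) (simp add: deform_def)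

lemma struct_is_zero_deform_iff:
  assumes "bracket_structure \<Theta>" "bundle_map A E E F"
  shows "struct_is_zero A E (deform E \<Theta> F) \<longleftrightarrow>
    (\<forall>p. \<forall>e\<in>fibre E p. fst \<Theta> (F e) = (p, \<lambda>f. 0)) \<and> C.D (hat F) (coord_bracket \<Theta>) = 0"
  using struct_is_zero_iff[OF bracket_structure_closed[OF bracket_structure_deform[OF assms(2,1)]]]
  by (simp add: coord_bracket_deform[OF assms(2,1)] fst_deform)

lemma poisson_tensor_iff:
  assumes "bracket_structure \<Theta>"
  shows "poisson_tensor A E g \<Theta> F \<longleftrightarrow> skew_tensor A E g F \<and>
    (\<forall>p. \<forall>e\<in>fibre E p. fst \<Theta> (F (F e)) = (p, \<lambda>f. 0)) \<and>
    C.D (hat F) (C.D (hat F) (coord_bracket \<Theta>)) = 0"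
\<comment> \<open>If \<open>F\<close> is not a bundle map, both sides are false, since each contains
  \<open>skew_tensor\<close>.\<close>
proof (cases "bundle_map A E E F")
  case True
  show ?thesis
    unfolding poisson_tensor_def struct_is_zero_deform_iff[OF bracket_structure_deform[OF True assms] True]
    by (simp add: coord_bracket_deform[OF True assms] fst_deform)
qed (simp add: poisson_tensor_def skew_tensor_def)

lemma nijenhuis_iff:
  assumes "bracket_structure \<Theta>" and F: "bundle_map A E E F"
  shows "nijenhuis A E \<Theta> F \<longleftrightarrow> C.torsion (hat F) (hat F) (coord_bracket \<Theta>) = 0"
proof -
  have eq: "sec_diff E (snd \<Theta> (F \<circ> X) (F \<circ> Y)) (F \<circ> snd (deform E \<Theta> F) X Y) = fzero E \<longleftrightarrow>
      C.torsion (hat F) (hat F) (coord_bracket \<Theta>) (coords X) (coords Y) = 0"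
    if X: "X \<in> sections A E" and Y: "Y \<in> sections A E" for X Y
  proof -
    note closed = bracket_structure_closed[OF assms(1)] bundle_map_section[OF F] deform_section[OF F assms(1)]
    have d: "coords (snd (deform E \<Theta> F) X Y) = C.D (hat F) (coord_bracket \<Theta>) (coords X) (coords Y)"
      by (simp add: coord_bracket_deform[OF F assms(1), symmetric] coord_bracket_coords X Y)
    have "coords (sec_diff E (snd \<Theta> (F \<circ> X) (F \<circ> Y)) (F \<circ> snd (deform E \<Theta> F) X Y))
      = C.torsion (hat F) (hat F) (coord_bracket \<Theta>) (coords X) (coords Y)"
      by (simp add: coords_simps closed X Y hat_coords[symmetric] d)
        (simp add: C.torsion_def C.D_def coords_section X Y C.endo_simps[OF endo_hat[OF F]]
          hat_coords coord_bracket_coords closed)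
    then show ?thesis
      using coords_eq_zero[of "sec_diff E (snd \<Theta> (F \<circ> X) (F \<circ> Y)) (F \<circ> snd (deform E \<Theta> F) X Y)"]
      by (simp add: section_diff closed X Y)
  qed
  have "C.torsion (hat F) (hat F) (coord_bracket \<Theta>) = 0 \<longleftrightarrow>
    (\<forall>x\<in>coord_sections. \<forall>y\<in>coord_sections. C.torsion (hat F) (hat F) (coord_bracket \<Theta>) x y = 0)"
    (is "?t = 0 \<longleftrightarrow> ?R")
  proof
    assume ?R
    \<comment> \<open>Arguments outside \<open>coord_sections\<close> impose no condition, as the
      torsion is 0 there by definition.\<close>
    then have "?t x y = 0" for x y
      by (cases "x \<in> coord_sections \<and> y \<in> coord_sections") (auto simp: C.torsion_def)
    then show "?t = 0" by (intro ext) (simp only: zero_fun_apply)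
  qed simp
  then show ?thesis
    unfolding nijenhuis_def using F eq by (simp add: coord_sections_def)
qed

lemma concomitant_iff:
  assumes "bracket_structure \<Theta>" and F: "bundle_map A E E F" and G: "bundle_map A E E G"
  shows "struct_is_zero A E (concomitant A E \<Theta> F G) \<longleftrightarrow>
    (\<forall>p. \<forall>e\<in>fibre E p. fadd (tangent_bundle A) (fst \<Theta> (F (G e))) (fst \<Theta> (G (F e))) = (p, \<lambda>f. 0)) \<and>
    C.D (hat G) (C.D (hat F) (coord_bracket \<Theta>)) + C.D (hat F) (C.D (hat G) (coord_bracket \<Theta>)) = 0"
proof -
  let ?FG = "deform E (deform E \<Theta> F) G" and ?GF = "deform E (deform E \<Theta> G) F"
  note FG = bracket_structure_deform[OF G bracket_structure_deform[OF F assms(1)]]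
  note GF = bracket_structure_deform[OF F bracket_structure_deform[OF G assms(1)]]
  note closed = bracket_structure_closed[OF FG] bracket_structure_closed[OF GF]
  have "coord_bracket (struct_add A E ?FG ?GF) = coord_bracket ?FG + coord_bracket ?GF"
    by (auto simp: fun_eq_iff coord_bracket_def struct_add_def coords_simps closed of_coords_section)
  then show ?thesis
    unfolding concomitant_def
    by (subst struct_is_zero_iff)
      (simp_all add: struct_add_def section_add closed fst_deform coord_bracket_deform F G
        bracket_structure_deform assms(1))
qed

lemma deform_iter_simps:
  assumes "bracket_structure \<Theta>" "bundle_map A E E F"
  shows "bracket_structure (deform_iter E \<Theta> F k)"
    and "coord_bracket (deform_iter E \<Theta> F k) = (C.D (hat F) ^^ k) (coord_bracket \<Theta>)"
    and "fst (deform_iter E \<Theta> F k) = fst \<Theta> \<circ> F ^^ k"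
proof -
  show *: "bracket_structure (deform_iter E \<Theta> F k)" for k
    by (induction k) (simp_all add: assms bracket_structure_deform)
  show "coord_bracket (deform_iter E \<Theta> F k) = (C.D (hat F) ^^ k) (coord_bracket \<Theta>)"
    by (induction k) (simp_all add: coord_bracket_deform[OF assms(2) *])
  show "fst (deform_iter E \<Theta> F k) = fst \<Theta> \<circ> F ^^ k"
    by (induction k) (simp_all add: fst_deform fun_eq_iff funpow_swap1)
qed


section \<open>The hierarchy\<close>

context
  fixes g :: "'e \<Rightarrow> 'e \<Rightarrow> real"
  assumes metric: "bundle_metric A E g"
begin

section \<open>Skew-symmetry of the tensors in the hierarchy\<close>

lemma metric_simps:
  assumes "u \<in> fibre E p" "v \<in> fibre E p" "w \<in> fibre E p"
  shows "g (fadd E u v) w = g u w + g v w" "g w (fadd E u v) = g w u + g w v"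
    and "g (fscale E c u) w = c * g u w" "g w (fscale E c u) = c * g w u"
proof -
  have sym: "g u v = g v u" if "u \<in> fibre E p" "v \<in> fibre E p" for u v
    using metric that unfolding bundle_metric_def by blast
  show "g (fadd E u v) w = g u w + g v w" "g (fscale E c u) w = c * g u w"
    using metric assms unfolding bundle_metric_def by blast+
  then show "g w (fadd E u v) = g w u + g w v" "g w (fscale E c u) = c * g w u"
    using sym assms fibre_closed by metis+
qed

lemma skew_tensorD:
  assumes "skew_tensor A E g F"
  shows "bundle_map A E E F" "u \<in> fibre E p \<Longrightarrow> v \<in> fibre E p \<Longrightarrow> g (F u) v = - g u (F v)"
proof -
  show "bundle_map A E E F" using assms by (simp add: skew_tensor_def)
  show "g (F u) v = - g u (F v)" if "u \<in> fibre E p" "v \<in> fibre E p"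
    using assms that unfolding skew_tensor_def eq_neg_iff_add_eq_0 by blast
qed

lemma skew_tensorI:
  assumes "bundle_map A E E F"
    and "\<And>p u v. u \<in> fibre E p \<Longrightarrow> v \<in> fibre E p \<Longrightarrow> g (F u) v = - g u (F v)"
  shows "skew_tensor A E g F"
  unfolding skew_tensor_def using assms by (metis add.left_inverse)

lemma skew_tensor_add:
  assumes F: "skew_tensor A E g F" and G: "skew_tensor A E g G"
  shows "skew_tensor A E g (tensor_add E F G)"
proof (rule skew_tensorI)
  show "bundle_map A E E (tensor_add E F G)"
    using F G by (intro bundle_map_add) (auto simp: skew_tensor_def)
  fix p u v assume uv: "u \<in> fibre E p" "v \<in> fibre E p"
  note mem = uv bundle_mapD(1)[OF skew_tensorD(1)[OF F]] bundle_mapD(1)[OF skew_tensorD(1)[OF G]]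
  show "g (tensor_add E F G u) v = - g u (tensor_add E F G v)"
    using skew_tensorD(2)[OF F uv] skew_tensorD(2)[OF G uv]
    by (simp add: tensor_add_def metric_simps[of _ p] mem)
qed

text \<open>Moving both factors across the metric produces two cancelling signs and reverses their
  order. Anticommutation restores the order and leaves one sign.\<close>

lemma skew_tensor_anticommuting_comp:
  assumes F: "skew_tensor A E g F" and G: "skew_tensor A E g G"
    and anti: "\<And>p u. u \<in> fibre E p \<Longrightarrow> G (F u) = fscale E (- 1) (F (G u))"
  shows "skew_tensor A E g (F \<circ> G)"
proof (rule skew_tensorI)
  show "bundle_map A E E (F \<circ> G)"
    using F G by (intro bundle_map_comp) (auto simp: skew_tensor_def)
  fix p u v assume uv: "u \<in> fibre E p" "v \<in> fibre E p"
  note mem = uv bundle_mapD(1)[OF skew_tensorD(1)[OF F]] bundle_mapD(1)[OF skew_tensorD(1)[OF G]]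
  have "g (F (G u)) v = g u (G (F v))"
    using skew_tensorD(2)[OF F, of "G u" p v] skew_tensorD(2)[OF G, of u p "F v"] by (simp add: mem)
  also have "\<dots> = - g u (F (G v))"
    unfolding anti[OF uv(2)]
    using metric_simps(4)[of "F (G v)" p "F (G v)" u "- 1"] by (simp add: mem)
  finally show "g ((F \<circ> G) u) v = - g u ((F \<circ> G) v)" by simp
qed

lemma skew_tensor_odd_funpow:
  assumes F: "skew_tensor A E g F"
  shows "skew_tensor A E g (F ^^ (2 * m + 1))"
proof (rule skew_tensorI)
  show "bundle_map A E E (F ^^ (2 * m + 1))"
    using F by (intro bundle_map_funpow) (simp add: skew_tensor_def)
  fix p u v assume uv: "u \<in> fibre E p" "v \<in> fibre E p"
  have mem: "(F ^^ n) w \<in> fibre E p" if "w \<in> fibre E p" for n w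
    using bundle_mapD(1)[OF bundle_map_funpow[OF skew_tensorD(1)[OF F]] that] .
  have "g ((F ^^ n) u) v = (- 1) ^ n * g u ((F ^^ n) v)" if "v \<in> fibre E p" for n v
    using that
  proof (induction n arbitrary: v)
    case (Suc n)
    have "g ((F ^^ Suc n) u) v = - g ((F ^^ n) u) (F v)"
      using skew_tensorD(2)[OF F mem[OF uv(1)] Suc.prems] by simp
    also have "\<dots> = (- 1) ^ Suc n * g u ((F ^^ Suc n) v)"
      using Suc.IH[OF mem[of v 1, simplified, OF Suc.prems]] by (simp add: funpow_swap1)
    finally show ?case .
  qed simp
  from this[OF uv(2), of "2 * m + 1"]
  show "g ((F ^^ (2 * m + 1)) u) v = - g u ((F ^^ (2 * m + 1)) v)" by simp
qed

theorem poisson_nijenhuis_hierarchy: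
  assumes \<Theta>: "bracket_structure \<Theta>" and anchor: "bundle_map A E (tangent_bundle A) (fst \<Theta>)"
    and skew_I: "skew_tensor A E g I" and skew_J: "skew_tensor A E g J"
    and pn: "poisson_nijenhuis_pair A E g \<Theta> J I"
    and deform_zero: "struct_is_zero A E (deform E \<Theta> (tensor_bracket E J (tensor_bracket E I J)))"
  shows "poisson_tensor A E g (deform_iter E \<Theta> I k) (I ^^ n \<circ> J)" (is ?poisson)
    and "compatible_poisson A E g (deform_iter E \<Theta> I k) (I ^^ m \<circ> J) (I ^^ n \<circ> J)" (is ?compatible)
    and "poisson_nijenhuis_pair A E g (deform_iter E \<Theta> I k) (I ^^ n \<circ> J) (I ^^ (2 * m + 1))" (is ?pair)
proof -
  note I = skew_tensorD(1)[OF skew_I] and J = skew_tensorD(1)[OF skew_J]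
  note In = bundle_map_funpow[OF I]
  note K = bundle_map_comp[OF In J]
  define \<rho> where "\<rho> = fst \<Theta>"
  have tot: "u \<in> tot_space E" if "u \<in> fibre E p" for u p
    using that by (simp add: fibre_def)
  have JI: "J (I u) = fscale E (- 1) (I (J u))" if "u \<in> fibre E p" for u p
    using pn tot[OF that] by (auto simp: poisson_nijenhuis_pair_def compatible_pair_def tensor_scale_def)
  have mem: "I u \<in> fibre E p" "J u \<in> fibre E p" "(I ^^ n) u \<in> fibre E p" if "u \<in> fibre E p" for u p n
    using that by (auto intro: bundle_mapD(1)[OF I] bundle_mapD(1)[OF J] bundle_mapD(1)[OF In])
  have scale: "I (fscale E c u) = fscale E c (I u)" "J (fscale E c u) = fscale E c (J u)"
    "(I ^^ n) (fscale E c u) = fscale E c ((I ^^ n) u)" if "u \<in> fibre E p" for u p c n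
    using that by (auto intro: bundle_mapD(3)[OF I] bundle_mapD(3)[OF J] bundle_mapD(3)[OF In])
  have scale_scale: "fscale E a (fscale E b u) = fscale E (a * b) u" "fscale E 1 u = u"
    if "u \<in> fibre E p" for u p a b
    by (rule coord_inject[THEN iffD1, of _ p]; simp add: that fibre_closed coord_simps(1,2))+
  \<comment> \<open>Fibres have no subtraction of their own, so signs are carried as scalars of
    \<open>fscale\<close>.\<close>
  have J_funpow: "J ((I ^^ n) u) = fscale E ((- 1) ^ n) ((I ^^ n) (J u))" if u: "u \<in> fibre E p" for u p n
  proof (induction n)
    case (Suc n)
    have "J ((I ^^ Suc n) u) = fscale E (- 1) (I (J ((I ^^ n) u)))"
      using JI[OF mem(3)[OF u]] by simp
    also have "\<dots> = fscale E (- 1) (fscale E ((- 1) ^ n) ((I ^^ Suc n) (J u)))"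
      using scale(1)[OF mem(3)[OF mem(2)[OF u]]] by (simp add: Suc)
    also have "\<dots> = fscale E ((- 1) ^ Suc n) ((I ^^ Suc n) (J u))"
      using scale_scale(1)[OF mem(3)[OF mem(2)[OF u], of "Suc n"]] by simp
    finally show ?case .
  qed (simp add: scale_scale(2)[OF mem(2)[OF u]])
  have J_odd: "J ((I ^^ (2 * m + 1)) u) = fscale E (- 1) ((I ^^ (2 * m + 1)) (J u))"
    if "u \<in> fibre E p" for u p m
    using J_funpow[OF that, of "2 * m + 1"] by simp
  have funpow_funpow: "(I ^^ a) ((I ^^ b) u) = (I ^^ (a + b)) u" for a b u
    by (simp add: funpow_add)
  have K_odd: "(I ^^ n) (J ((I ^^ (2 * m + 1)) u)) = fscale E (- 1) ((I ^^ (2 * m + 1)) ((I ^^ n) (J u)))"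
    if u: "u \<in> fibre E p" for u p m n
    unfolding J_odd[OF u] scale(3)[OF mem(3)[OF mem(2)[OF u]]] funpow_funpow by (simp only: add.commute)

  have \<rho>_lin: "\<rho> u \<in> fibre (tangent_bundle A) p"
    "\<rho> (fadd E u v) = fadd (tangent_bundle A) (\<rho> u) (\<rho> v)"
    "\<rho> (fscale E c u) = fscale (tangent_bundle A) c (\<rho> u)"
    if "u \<in> fibre E p" "v \<in> fibre E p" for u v p c
    using anchor that unfolding bundle_map_def \<rho>_def by blast+
  have J_poisson: "C.D (hat J) (C.D (hat J) (coord_bracket \<Theta>)) = 0"
    and \<rho>_J: "\<rho> (J (J u)) = (p, \<lambda>f. 0)" if "u \<in> fibre E p" for u p
    using pn that poisson_tensor_iff[OF \<Theta>, of g J]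
    by (auto simp: poisson_nijenhuis_pair_def \<rho>_def)
  \<comment> \<open>\<open>J \<circ> J\<close> commutes with \<open>I ^^ N\<close>, because the sign
    \<open>(- 1) ^ N\<close> occurs twice. The vector thus lies in the image of
    \<open>J \<circ> J\<close>, where the anchor vanishes.\<close>
  have \<rho>_IJJ: "\<rho> ((I ^^ N) (J (J u))) = (p, \<lambda>f. 0)" if u: "u \<in> fibre E p" for u p N
  proof -
    have "J (J ((I ^^ N) u)) = fscale E ((- 1) ^ N) (fscale E ((- 1) ^ N) ((I ^^ N) (J (J u))))"
      using J_funpow[OF mem(2)[OF u]] by (simp add: J_funpow[OF u] scale(2)[OF mem(3)[OF mem(2)[OF u]]])
    also have "\<dots> = (I ^^ N) (J (J u))"
      by (simp add: scale_scale[OF mem(3)[OF mem(2)[OF mem(2)[OF u]]]] power_mult_distrib[symmetric])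
    finally show ?thesis using \<rho>_J[OF mem(3)[OF u]] by metis
  qed
  \<comment> \<open>This covers the anchor conditions for Poisson tensors and for their sums: a
    product of two members of the hierarchy is, up to sign, a power of \<open>I\<close> after
    \<open>J \<circ> J\<close>.\<close>
  have \<rho>_KK: "\<rho> ((I ^^ k) ((I ^^ m) (J ((I ^^ n) (J u))))) = (p, \<lambda>f. 0)" if u: "u \<in> fibre E p" for u p k m n
  proof -
    have w: "(I ^^ n) (J (J u)) \<in> fibre E p" for n by (intro mem u)
    have "(I ^^ k) ((I ^^ m) (J ((I ^^ n) (J u)))) = fscale E ((- 1) ^ n) ((I ^^ (k + (m + n))) (J (J u)))"
      by (simp only: J_funpow[OF mem(2)[OF u]] scale(3)[OF w] funpow_funpow)
    then show ?thesis
      using \<rho>_lin(3)[OF w w] \<rho>_IJJ[OF u] by (simp add: tangent_bundle_def)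
  qed

  define \<phi> where "\<phi> = coord_bracket \<Theta>"
  interpret P: anticommuting_endos coord_sections "hat I" "hat J"
  proof
    show "C.endo (hat I)" "C.endo (hat J)" by (intro endo_hat I J)+
    show "hat J (hat I x) = - hat I (hat J x)" for x
    proof -
      have "coord p (J (I (of_coords x p))) = - coord p (I (J (of_coords x p)))" for p
        by (simp add: JI[OF of_coords_fibre] coord_simps(2) mem of_coords_fibre)
      then show ?thesis
        unfolding hat_def[of J "hat I x"] hat_def[of I "hat J x"] of_coords_hat[OF I] of_coords_hat[OF J]
        by (simp add: coords_def fun_eq_iff)
    qed
    show "x = 0" if "x + x = 0" for x :: "'m \<Rightarrow> 'f"
    proof (intro ext)
      fix p show "x p = 0 p"
        using double_eq_zero_real_vector[of "x p"] fun_cong[OF that, of p] by simp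
    qed
    show "x = 0" if "x + x + x = 0" for x :: "'m \<Rightarrow> 'f"
    proof (intro ext)
      fix p show "x p = 0 p"
        using triple_eq_zero_real_vector[of "x p"] fun_cong[OF that, of p] by simp
    qed
  qed
  have \<phi>: "\<phi> \<in> C.brackets" using \<Theta> by (simp add: bracket_structure_def \<phi>_def)
  have pn_\<phi>: "P.pn_bracket \<phi>"
  proof -
    let ?IJJ = "hat I \<circ> (hat J \<circ> hat J)"
    have endo: "C.endo ?IJJ" by (intro C.endo_comp P.endo_I P.endo_J)
    have "C.torsion (hat I) (hat I) \<phi> = 0"
      using pn nijenhuis_iff[OF \<Theta> I] by (simp add: poisson_nijenhuis_pair_def \<phi>_def)
    moreover have "C.D (hat I) (C.D (hat J) \<phi>) + C.D (hat J) (C.D (hat I) \<phi>) = 0"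
      using pn concomitant_iff[OF \<Theta> J I]
      by (simp add: poisson_nijenhuis_pair_def compatible_pair_def \<phi>_def)
    moreover have "C.D (hat J) (C.D (hat J) \<phi>) = 0"
      \<comment> \<open>\<open>J_poisson\<close> carries the fibre membership assumed for
        \<open>\<rho>_J\<close>; the zero vector discharges it.\<close>
      using J_poisson[OF fibre_closed(1)] by (simp add: \<phi>_def)
    moreover have "C.D ?IJJ \<phi> = 0"
    proof -
      let ?T = "tensor_bracket E J (tensor_bracket E I J)"
      \<comment> \<open>By anticommutation \<open>{I, J}\<close> is - 2 times
        \<open>I \<circ> J\<close>, and bracketing with \<open>J\<close> doubles the factor to - 4.
        The multiple is spelled out as a sum because the algebraic part has addition only.\<close>
      have hat_T: "hat ?T = (\<lambda>x. - ((?IJJ x + ?IJJ x) + (?IJJ x + ?IJJ x)))"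
        by (rule ext) (simp add: hat_tensor_bracket bundle_map_tensor_bracket I J P.anticommute
            C.endo_simps[OF P.endo_I] C.endo_simps[OF P.endo_J])
      have "C.D (hat ?T) \<phi> = 0"
        using deform_zero struct_is_zero_deform_iff[OF \<Theta>, of ?T]
        by (simp add: bundle_map_tensor_bracket I J \<phi>_def)
      then have "C.D (\<lambda>x. - ((?IJJ x + ?IJJ x) + (?IJJ x + ?IJJ x))) \<phi> = 0"
        unfolding hat_T .
      moreover have "C.D (\<lambda>x. - ((?IJJ x + ?IJJ x) + (?IJJ x + ?IJJ x))) \<phi>
        = - ((C.D ?IJJ \<phi> + C.D ?IJJ \<phi>) + (C.D ?IJJ \<phi> + C.D ?IJJ \<phi>))"
        using \<phi> C.endo_closed[OF endo]
        by (auto simp: C.D_def fun_eq_iff C.br_simps C.uminus_closed C.add_closed C.diff_closed simp del: comp_apply)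
      ultimately have "(C.D ?IJJ \<phi> + C.D ?IJJ \<phi>) + (C.D ?IJJ \<phi> + C.D ?IJJ \<phi>) = 0"
        by (simp only: neg_equal_0_iff_equal)
      \<comment> \<open>Four equal copies add up to 0, so halving is applied twice.\<close>
      then show ?thesis by (rule P.double_zero_bracket[OF P.double_zero_bracket])
    qed
    ultimately show ?thesis
      using \<phi> by (simp add: P.pn_bracket_def P.pn_compatible_def)
  qed

  note it = deform_iter_simps[OF \<Theta> I]
  note pn_k = P.pn_bracket_D_I_funpow[OF pn_\<phi>]
  have hat_K: "hat (I ^^ n \<circ> J) = hat I ^^ n \<circ> hat J" for n
    by (simp add: hat_comp hat_funpow I J)
  \<comment> \<open>\<open>I ^^ n \<circ> J\<close> anticommutes with \<open>I\<close>, the sign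
    coming from the single \<open>J\<close>. Skew-symmetry therefore propagates by composing with
    one more \<open>I\<close>.\<close>
  have skew_K: "skew_tensor A E g (I ^^ n \<circ> J)" for n
  proof (induction n)
    case (Suc n)
    have "(I ^^ n \<circ> J) (I u) = fscale E (- 1) (I ((I ^^ n \<circ> J) u))" if u: "u \<in> fibre E p" for u p
      using scale(3)[OF mem(1)[OF mem(2)[OF u]]] by (simp add: JI[OF u] funpow_swap1)
    then have "skew_tensor A E g (I \<circ> (I ^^ n \<circ> J))"
      by (rule skew_tensor_anticommuting_comp[OF skew_I Suc])
    then show ?case by (simp only: funpow.simps comp_assoc)
  qed (simp add: skew_J)

  \<comment> \<open>The k-fold deformation has bracket \<open>(C.D (hat I) ^^ k) \<phi>\<close>,
    again a \<open>pn_bracket\<close>, so \<open>P.D_IJ_D_IJ\<close> applies with equal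
    indices.\<close>
  have poisson: "poisson_tensor A E g (deform_iter E \<Theta> I k) (I ^^ n \<circ> J)" for n k
    unfolding poisson_tensor_iff[OF it(1)] it hat_K \<phi>_def[symmetric] \<rho>_def[symmetric] P.D_IJ_D_IJ[OF pn_k]
      comp_apply
    by (intro conjI allI ballI skew_K[unfolded comp_def] \<rho>_KK refl)
  then show ?poisson .

  show ?compatible
    unfolding compatible_poisson_def
  proof (intro conjI poisson)
    let ?F = "I ^^ m \<circ> J" and ?G = "I ^^ n \<circ> J"
    let ?T = "tensor_add E ?F ?G"
    have T: "bundle_map A E E ?T" by (intro bundle_map_add K)
    \<comment> \<open>The square of the sum expands into four products, and \<open>\<rho>_KK\<close>
      annihilates each of them.\<close>
    have anchor_T: "\<rho> ((I ^^ k) (?T (?T u))) = (p, \<lambda>f. 0)" if u: "u \<in> fibre E p" for u p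
    proof -
      have FG: "?F v \<in> fibre E p" "?G v \<in> fibre E p" if "v \<in> fibre E p" for v
        using bundle_mapD(1)[OF K that] by auto
      have "(I ^^ k) (?T (?T u)) = fadd E (fadd E ((I ^^ k) (?F (?F u))) ((I ^^ k) (?F (?G u))))
          (fadd E ((I ^^ k) (?G (?F u))) ((I ^^ k) (?G (?G u))))"
        unfolding tensor_add_def
        by (simp only: bundle_mapD(2)[OF K FG(1)[OF u] FG(2)[OF u]] bundle_mapD(2)[OF In, of _ p] FG u fibre_closed)
      moreover have "(I ^^ k) (?F (?F u)) \<in> fibre E p" "(I ^^ k) (?F (?G u)) \<in> fibre E p"
        "(I ^^ k) (?G (?F u)) \<in> fibre E p" "(I ^^ k) (?G (?G u)) \<in> fibre E p"
        by (intro mem(3) FG u)+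
      ultimately show ?thesis
        using \<rho>_KK[OF u] by (simp add: \<rho>_lin(2)[of _ p] fibre_closed tangent_bundle_def)
    qed
    \<comment> \<open>The same expansion for brackets; \<open>P.D_IJ_D_IJ\<close> also treats the
      mixed compositions.\<close>
    have "C.D (hat ?T) (C.D (hat ?T) ((C.D (hat I) ^^ k) \<phi>)) = 0"
    proof -
      note e = endo_hat[OF K, of m, unfolded hat_K] endo_hat[OF K, of n, unfolded hat_K]
      note b = C.D_funpow_brackets[OF P.endo_I \<phi>, of k]
      show ?thesis
        by (simp only: hat_add[OF K K] hat_K C.D_plus_endo[OF b e] C.D_plus[OF e(1)] C.D_plus[OF e(2)]
            C.D_plus_endo[OF C.add_brackets[OF C.D_brackets[OF e(1) b] C.D_brackets[OF e(2) b]] e]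
            P.D_IJ_D_IJ[OF pn_k] add_0)
    qed
    then show "poisson_tensor A E g (deform_iter E \<Theta> I k) ?T"
      unfolding poisson_tensor_iff[OF it(1)]
      unfolding it \<phi>_def[symmetric] \<rho>_def[symmetric] comp_apply[of \<rho>]
      using skew_tensor_add[OF skew_K skew_K] anchor_T by blast
  qed

  show ?pair
    unfolding poisson_nijenhuis_pair_def compatible_pair_def
  proof (intro conjI poisson skew_K skew_tensor_odd_funpow skew_I ballI)
    let ?F = "I ^^ n \<circ> J" and ?G = "I ^^ (2 * m + 1)"
    have swap: "?F (?G u) = fscale E (- 1) (?G (?F u))" if "u \<in> fibre E p" for u p
      using K_odd[OF that] by (simp only: comp_apply)
    show "(?F \<circ> ?G) e = tensor_scale E (- 1) (?G \<circ> ?F) e" if "e \<in> tot_space E" for e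
      using swap[of e "bproj E e"] that unfolding tensor_scale_def comp_apply by (simp only: fibre_def mem_Collect_eq simp_thms)
    \<comment> \<open>Here the two anchor values need not vanish individually: they are opposite, by
      anticommutation of \<open>?F\<close> and \<open>?G\<close>.\<close>
    have "fadd (tangent_bundle A) (\<rho> ((I ^^ k) (?F (?G e)))) (\<rho> ((I ^^ k) (?G (?F e)))) = (p, \<lambda>f. 0)"
      if e: "e \<in> fibre E p" for e p
    proof -
      have GF: "?G (?F e) \<in> fibre E p" by (intro bundle_mapD(1)[OF In] bundle_mapD(1)[OF K] e)
      note kGF = mem(3)[OF GF, of k]
      have "\<rho> ((I ^^ k) (?F (?G e))) = fscale (tangent_bundle A) (- 1) (\<rho> ((I ^^ k) (?G (?F e))))"
        unfolding swap[OF e] scale(3)[OF GF] \<rho>_lin(3)[OF kGF kGF] ..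
      then show ?thesis
        using \<rho>_lin(1)[OF kGF kGF]
        by (cases "\<rho> ((I ^^ k) (?G (?F e)))") (auto simp: tangent_bundle_def fibre_def)
    qed
    moreover have "C.D (hat ?G) (C.D (hat ?F) ((C.D (hat I) ^^ k) \<phi>))
        + C.D (hat ?F) (C.D (hat ?G) ((C.D (hat I) ^^ k) \<phi>)) = 0"
      using P.D_I_odd_D_IJ[OF pn_k] unfolding hat_K hat_funpow[OF I] by (simp only: add.commute)
    ultimately show "struct_is_zero A E (concomitant A E (deform_iter E \<Theta> I k) ?F ?G)"
      unfolding concomitant_iff[OF it(1) K In] it \<phi>_def[symmetric] \<rho>_def[symmetric] comp_apply by blast
    \<comment> \<open>This is \<open>C.torsion_funpow\<close> with both exponents
      \<open>2 * m + 1\<close>, at the iterated bracket, on which the torsion of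
      \<open>hat I\<close> still vanishes.\<close>
    have "C.torsion (hat ?G) (hat ?G) ((C.D (hat I) ^^ k) \<phi>) = 0"
      unfolding hat_funpow[OF I]
      using P.pn_compatibleD[OF P.pn_bracketD(1)[OF pn_k]] by (intro C.torsion_funpow P.endo_I)
    then show "nijenhuis A E (deform_iter E \<Theta> I k) ?G"
      unfolding nijenhuis_iff[OF it(1) In] it \<phi>_def[symmetric] .
  qed
qed

end

end

theorem theorem3p19:
  fixes A :: "('m::{t2_space, second_countable_topology}, 'n::real_normed_vector) atlas"
    and E :: "('m, 'e, 'f::real_normed_vector) vbundle"
    and g :: "'e \<Rightarrow> 'e \<Rightarrow> real"
    and \<Theta> :: "('m, 'e) cstruct"
    and I J :: "'e \<Rightarrow> 'e"
  assumes "pre_courant_algebroid A E g \<Theta>"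
    and "skew_tensor A E g I"
    and "skew_tensor A E g J"
    and "poisson_nijenhuis_pair A E g \<Theta> J I"
    and "struct_is_zero A E (deform E \<Theta> (tensor_bracket E J (tensor_bracket E I J)))"
  shows "(\<forall>n k. poisson_tensor A E g (deform_iter E \<Theta> I k) (I ^^ n \<circ> J)) \<and>
    (\<forall>k m n. compatible_poisson A E g (deform_iter E \<Theta> I k) (I ^^ m \<circ> J) (I ^^ n \<circ> J)) \<and>
    (\<forall>m n k. poisson_nijenhuis_pair A E g (deform_iter E \<Theta> I k) (I ^^ n \<circ> J) (I ^^ (2 * m + 1)))"
proof -
  interpret smooth_vector_bundle A E
    using assms(1) by unfold_locales (simp_all add: pre_courant_algebroid_def)
  have metric: "bundle_metric A E g" and courant: "pre_courant_structure A E g \<Theta>"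
    using assms(1) by (simp_all add: pre_courant_algebroid_def)
  have anchor: "bundle_map A E (tangent_bundle A) (fst \<Theta>)"
    using courant by (cases \<Theta>) (simp add: pre_courant_structure_def)
  note hierarchy = poisson_nijenhuis_hierarchy[OF metric bracket_structure_pre_courant[OF courant]
      anchor assms(2-5)]
  show ?thesis
    by (intro conjI allI hierarchy)
qed

end
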